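(* Let $f:\mathbb{R}^n\to\mathbb{R}$ be a twice differentiable function and consider the gradient descent system $$\dot{\mathbf{x}} = -\nabla f(\mathbf{x}).$$ If this system is contracting in some metric, then the system converges exponentially to a unique global minimum of $f$; that is, $f$ has a unique global minimizer $\mathbf{x}^\star$, and every solution of the system converges exponentially to $\mathbf{x}^\star$.
   Context: All functions are assumed sufficiently smooth that derivatives of the necessary order exist and are continuous. A metric is a function $\mathbf{P}:\mathbb{R}^n\to\mathbb{R}^{n\times n}$ whose values are symmetric positive definite matrices. A system $\dot{\mathbf{x}}=\mathbf{h}(\mathbf{x},t)$ on $\mathbb{R}^n$ is contracting at rate $\alpha>0$ with respect to the metric $\mathbf{P}$ if for all $t\in\mathbb{R}$ and all $\mathbf{x}\in\mathbb{R}^n$, $$\dot{\mathbf{P}}+\mathbf{A}^\top\mathbf{P}+\mathbf{P}\mathbf{A}\preceq -2\alpha\mathbf{P},$$ where $\mathbf{A}(\mathbf{x},t)=\frac{\partial \mathbf{h}}{\partial\mathbf{x}}$ is the Jacobian and $\dot{\mathbf{P}}=\sum_i \frac{\partial\mathbf{P}}{\partial x_i}h_i(\mathbf{x},t)$. "Contracting in some metric" means that there exist such a metric $\mathbf{P}$ and a rate $\alpha>0$. Exponential convergence of two solutions $\mathbf{x}_1(t),\mathbf{x}_2(t)$ is understood in the geodesic distance $d_{\mathbf{P}}$ of the Riemannian manifold $(\mathbb{R}^n,\mathbf{P})$: $d_{\mathbf{P}}(\mathbf{x}_1(t),\mathbf{x}_2(t))\le e^{-\alpha t}d_{\mathbf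{P}}(\mathbf{x}_1(0),\mathbf{x}_2(0))$.
   Formalization: The metric P is additionally assumed complete (R^n with its geodesic distance d_P is a complete metric space); without this the claim fails, e.g. for f(x) = x_1 and P(x) = exp(2αx_1) I, which is contracting at rate α although f has no minimizer. *)

theory Defs
  imports "HOL-Analysis.Analysis"
begin

section \<open>Smoothness and gradients\<close>

definition C1_map :: "('a::real_normed_vector \<Rightarrow> 'b::real_normed_vector) \<Rightarrow> bool" where
  "C1_map F \<longleftrightarrow> (\<exists>F' :: 'a \<Rightarrow> 'a \<Rightarrow>\<^sub>L 'b.
     (\<forall>x. (F has_derivative blinfun_apply (F' x)) (at x)) \<and> continuous_on UNIV F')"

definition C2_map :: "('a::real_normed_vector \<Rightarrow> 'b::real_normed_vector) \<Rightarrow> bool" where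
  "C2_map F \<longleftrightarrow> (\<exists>F' :: 'a \<Rightarrow> 'a \<Rightarrow>\<^sub>L 'b.
     (\<forall>x. (F has_derivative blinfun_apply (F' x)) (at x)) \<and> C1_map F')"

definition gradient :: "('a::real_inner \<Rightarrow> real) \<Rightarrow> 'a \<Rightarrow> 'a" where
  "gradient f x = (THE D. GDERIV f x :> D)"

lemma gradient_eqI:
  assumes "GDERIV f x :> D"
  shows "gradient f x = D"
  unfolding gradient_def
proof (rule the_equality[of "\<lambda>D. GDERIV f x :> D", OF assms])
  fix E assume "GDERIV f x :> E"
  then have "(\<lambda>h. h \<bullet> E) = (\<lambda>h. h \<bullet> D)"
    using assms has_derivative_unique unfolding gderiv_def by blast
  then have "\<forall>h. h \<bullet> E = h \<bullet> D" by metis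
  then show "E = D" by (simp add: vector_eq_ldot)
qed

section \<open>Symmetric positive definite metrics\<close>

definition posdef :: "real ^ 'n ^ 'n \<Rightarrow> bool" where
  "posdef M \<longleftrightarrow> transpose M = M \<and> (\<forall>v. v \<noteq> 0 \<longrightarrow> v \<bullet> (M *v v) > 0)"

text \<open>The Loewner order; it is only used between symmetric matrices.\<close>

definition loewner_le :: "real ^ 'n ^ 'n \<Rightarrow> real ^ 'n ^ 'n \<Rightarrow> bool" (infix "\<preceq>\<^sub>L" 50) where
  "M \<preceq>\<^sub>L N \<longleftrightarrow> (\<forall>v. v \<bullet> ((N - M) *v v) \<ge> 0)"

definition riemannian_metric :: "(real ^ 'n \<Rightarrow> real ^ 'n ^ 'n) \<Rightarrow> bool" where
  "riemannian_metric P \<longleftrightarrow> C1_map P \<and> (\<forall>x. posdef (P x))"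

definition speed :: "(real ^ 'n \<Rightarrow> real ^ 'n ^ 'n) \<Rightarrow> (real \<Rightarrow> real ^ 'n) \<Rightarrow> real \<Rightarrow> real" where
  "speed P \<gamma> s =
     sqrt (vector_derivative \<gamma> (at s) \<bullet> (P (\<gamma> s) *v vector_derivative \<gamma> (at s)))"

text \<open>
  The infimum of the lengths of the piecewise continuously differentiable curves joining
  two points. The library's notion of a piecewise C1 curve allows the derivative to be unbounded
  near the exceptional points, hence curves of infinite length; \<open>has_integral\<close> excludes these,
  whereas \<open>integral\<close> would assign them the length 0.
\<close>

definition geodesic_dist ::
  "(real ^ 'n \<Rightarrow> real ^ 'n ^ 'n) \<Rightarrow> real ^ 'n \<Rightarrow> real ^ 'n \<Rightarrow> real" where
  "geodesic_dist P x y = Inf {L. \<exists>\<gamma>. valid_path \<gamma> \<and> pathstart \<gamma> = x \<and> pathfinish \<gamma> = y \<and>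
     (speed P \<gamma> has_integral L) {0..1}}"

text \<open>
  Completeness cannot be dropped when contraction is to yield an equilibrium: with \<open>f x = x $ i\<close> and
  \<open>P x = exp (2 * \<alpha> * x $ i) *\<^sub>R mat 1\<close>, gradient descent is contracting at rate \<open>\<alpha>\<close>, but
  \<open>f\<close> has no minimizer. A metric bounded below by a positive multiple of \<open>mat 1\<close> is complete.
\<close>

definition complete_metric :: "(real ^ 'n \<Rightarrow> real ^ 'n ^ 'n) \<Rightarrow> bool" where
  "complete_metric P \<longleftrightarrow> Metric_space.mcomplete UNIV (geodesic_dist P)"

section \<open>Contracting systems\<close>

text \<open>The derivative of the metric along the vector field \<open>h\<close>: the sum of the
  partial derivatives of \<open>P\<close> weighted by the components of \<open>h\<close>.\<close>

definition metric_dot ::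
  "(real ^ 'n \<Rightarrow> real ^ 'n ^ 'n) \<Rightarrow> (real ^ 'n \<Rightarrow> real \<Rightarrow> real ^ 'n) \<Rightarrow> real ^ 'n \<Rightarrow> real
     \<Rightarrow> real ^ 'n ^ 'n" where
  "metric_dot P h x t = (\<Sum>i\<in>UNIV. (h x t $ i) *\<^sub>R frechet_derivative P (at x) (axis i 1))"

definition contracting ::
  "(real ^ 'n \<Rightarrow> real \<Rightarrow> real ^ 'n) \<Rightarrow> (real ^ 'n \<Rightarrow> real ^ 'n ^ 'n) \<Rightarrow> real \<Rightarrow> bool" where
  "contracting h P \<alpha> \<longleftrightarrow> \<alpha> > 0 \<and> riemannian_metric P \<and>
     (\<forall>t x. let A = jacobian (\<lambda>y. h y t) (at x) in
        metric_dot P h x t + transpose A ** P x + P x ** A \<preceq>\<^sub>L (- 2 * \<alpha>) *\<^sub>R P x)"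

definition solution :: "(real ^ 'n \<Rightarrow> real \<Rightarrow> real ^ 'n) \<Rightarrow> (real \<Rightarrow> real ^ 'n) \<Rightarrow> bool" where
  "solution h x \<longleftrightarrow>
     (\<forall>t\<ge>0. (x has_vector_derivative h (x t) t) (at t within {0..}))"

abbreviation gradient_descent :: "(real ^ 'n \<Rightarrow> real) \<Rightarrow> real ^ 'n \<Rightarrow> real \<Rightarrow> real ^ 'n" where
  "gradient_descent f \<equiv> (\<lambda>x t. - gradient f x)"

end

theory Submission
  imports Defs
begin

text \<open>
  Along a solution the velocity \<open>g x\<close> and, up to higher order, the difference of two nearby solutions
  solve the linearised equation, so their \<open>P\<close>-norms decay exponentially. Decay of the velocity bounds
  the length of a solution, hence by completeness it cannot blow up in finite time and it converges
  to an equilibrium. Summing the decay of small differences over a fine subdivision of a curve shows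
  that the flow contracts \<open>geodesic_dist P\<close>, so all solutions converge to this equilibrium; since \<open>f\<close>
  decreases along solutions, the equilibrium is the unique minimizer.
\<close>

section \<open>Quadratic forms\<close>

text \<open>Existence, contraction and convergence hold for any autonomous C1 field; the gradient
  structure enters only at the end, through the monotonicity of \<open>f\<close>. Autonomy is what
  makes the velocity a solution of the linearised equation. The obstacle is that the contraction
  hypothesis is infinitesimal and \<open>P\<close> varies from point to point, while distances are
  infima over curves that are only piecewise C1. Estimates are therefore made with the form frozen
  at one point, and they cost something: the remainder of the linearisation lowers the rate \<alpha>
  to some \<beta> < \<alpha>, and the variation of \<open>P\<close> costs factors k > 1. Neither
  loss grows with the number of subintervals, since lengths add up along the curve, so both
  disappear in a limit at the very end. Completeness concerns Cauchy sequences of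
  \<open>geodesic_dist P\<close>, whereas local existence and the continuity of \<open>f\<close>
  refer to the norm; lower bounds for lengths link the two.\<close>

definition qform :: "real ^ 'n ^ 'n \<Rightarrow> real ^ 'n \<Rightarrow> real" where
  "qform M v = v \<bullet> (M *v v)"

lemma bounded_bilinear_matrix_vector_mult:
  "bounded_bilinear ((*v) :: real ^ 'n ^ 'm \<Rightarrow> real ^ 'n \<Rightarrow> real ^ 'm)"
proof (rule bilinear_conv_bounded_bilinear[THEN iffD1])
  show "bilinear ((*v) :: real ^ 'n ^ 'm \<Rightarrow> real ^ 'n \<Rightarrow> real ^ 'm)"
    unfolding bilinear_def linear_iff
    by (auto simp: matrix_vector_mult_add_rdistrib matrix_vector_right_distrib
        matrix_vector_mult_scaleR scaleR_matrix_vector_assoc)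
qed

lemma matrix_vector_mult_norm_bound:
  obtains K where "K > 0" "\<And>(M :: real ^ 'n ^ 'm) v. norm (M *v v) \<le> norm M * norm v * K"
  using bounded_bilinear.pos_bounded[OF bounded_bilinear_matrix_vector_mult] by blast

lemma continuous_on_matrix_vector [continuous_intros]:
  fixes M :: "'a::topological_space \<Rightarrow> real ^ 'n ^ 'm"
  assumes "continuous_on S M" "continuous_on S v"
  shows "continuous_on S (\<lambda>x. M x *v v x)"
  by (rule bounded_bilinear.continuous_on[OF bounded_bilinear_matrix_vector_mult assms])

lemma continuous_on_qform [continuous_intros]:
  assumes "continuous_on S M" "continuous_on S v"
  shows "continuous_on S (\<lambda>x. qform (M x) (v x))"
  unfolding qform_def by (intro continuous_intros assms)

lemma qform_scaleR [simp]: "qform M (c *\<^sub>R v) = c\<^sup>2 * qform M v"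
  by (simp add: qform_def matrix_vector_mult_scaleR power2_eq_square)

lemma qform_zero [simp]: "qform M 0 = 0"
  by (simp add: qform_def)

lemma qform_uminus [simp]: "qform M (- v) = qform M v"
  using qform_scaleR[of M "-1" v] by simp

lemma qform_minus_commute: "qform M (u - v) = qform M (v - u)"
  by (metis minus_diff_eq qform_uminus)

lemma symmetric_inner:
  fixes M :: "real ^ 'n ^ 'n"
  assumes "transpose M = M"
  shows "u \<bullet> (M *v v) = v \<bullet> (M *v u)"
  by (metis assms dot_lmul_matrix inner_commute transpose_matrix_vector)

lemma posdef_sym: "posdef M \<Longrightarrow> u \<bullet> (M *v v) = v \<bullet> (M *v u)"
  unfolding posdef_def by (blast intro: symmetric_inner)

lemma posdef_qform_pos: "posdef M \<Longrightarrow> v \<noteq> 0 \<Longrightarrow> qform M v > 0"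
  by (simp add: posdef_def qform_def)

lemma posdef_qform_nonneg [simp]: "posdef M \<Longrightarrow> qform M v \<ge> 0"
  by (cases "v = 0") (auto simp: less_imp_le posdef_qform_pos)

lemma posdef_qform_eq_0 [simp]: "posdef M \<Longrightarrow> qform M v = 0 \<longleftrightarrow> v = 0"
  using posdef_qform_pos[of M v] by (metis less_irrefl qform_zero)

lemma posdef_Cauchy_Schwarz:
  assumes "posdef M"
  shows "u \<bullet> (M *v v) \<le> sqrt (qform M u) * sqrt (qform M v)"
proof (cases "u = 0 \<or> v = 0")
  case True
  then show ?thesis by auto
next
  case False
  let ?a = "sqrt (qform M u)" and ?b = "sqrt (qform M v)"
  have pos: "?a > 0" "?b > 0" using False posdef_qform_pos[OF assms] by auto
  have sq: "qform M u = ?a * ?a" "qform M v = ?b * ?b" using assms by auto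
  \<comment> \<open>The crosswise weights give both vectors the same length, so the expansion is
    \<open>2 * ?a * ?b\<close> times the gap in the claimed inequality.\<close>
  have "0 \<le> qform M (?b *\<^sub>R u - ?a *\<^sub>R v)" using assms by simp
  also have "\<dots> = ?b\<^sup>2 * qform M u + ?a\<^sup>2 * qform M v - 2 * ?a * ?b * (u \<bullet> (M *v v))"
    using posdef_sym[OF assms, of v u]
    by (simp add: qform_def algebra_simps inner_diff_left inner_diff_right power2_eq_square)
  also have "\<dots> = ?b\<^sup>2 * (?a * ?a) + ?a\<^sup>2 * (?b * ?b) - 2 * ?a * ?b * (u \<bullet> (M *v v))"
    using sq by presburger
  also have "\<dots> = 2 * (?a * ?b) * (?a * ?b - u \<bullet> (M *v v))" by algebra
  finally show ?thesis using mult_pos_pos[OF pos] by (simp add: zero_le_mult_iff)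
qed

text \<open>Product rule twice; the symmetry of \<open>M t\<close> merges the two terms in which
  \<open>u\<close> is differentiated.\<close>

lemma has_real_derivative_qform:
  assumes "(u has_vector_derivative u') (at t)" "(M has_vector_derivative M') (at t)"
    and "transpose (M t) = M t"
  shows "((\<lambda>t. qform (M t) (u t)) has_real_derivative
           2 * (u' \<bullet> (M t *v u t)) + qform M' (u t)) (at t)"
proof -
  have "((\<lambda>t. M t *v u t) has_vector_derivative (M t *v u' + M' *v u t)) (at t)"
    by (rule bounded_bilinear.has_vector_derivative
        [OF bounded_bilinear_matrix_vector_mult assms(2,1)])
  from bounded_bilinear.has_vector_derivative[OF bounded_bilinear_inner assms(1) this]
  have "((\<lambda>t. qform (M t) (u t)) has_vector_derivative
      (u t \<bullet> (M t *v u' + M' *v u t) + u' \<bullet> (M t *v u t))) (at t)"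
    by (simp add: qform_def)
  moreover have "u t \<bullet> (M t *v u' + M' *v u t) + u' \<bullet> (M t *v u t) =
      2 * (u' \<bullet> (M t *v u t)) + qform M' (u t)"
    using symmetric_inner[OF assms(3), of "u t" u'] by (simp add: inner_right_distrib qform_def)
  ultimately show ?thesis by (simp add: has_real_derivative_iff_has_vector_derivative)
qed

section \<open>Scalar tools: decay from a differential inequality, first hitting times\<close>

text \<open>The product \<open>exp (c * t) * \<phi> t\<close> is nonincreasing. Derivatives are
  asked for only at interior times, where a solution on a compact interval has two-sided
  derivatives.\<close>

lemma exp_decay:
  fixes \<phi> :: "real \<Rightarrow> real"
  assumes "0 \<le> T" "continuous_on {0..T} \<phi>"
    and "\<And>t. 0 < t \<Longrightarrow> t < T \<Longrightarrow> (\<phi> has_real_derivative \<phi>' t) (at t)"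
    and "\<And>t. 0 < t \<Longrightarrow> t < T \<Longrightarrow> \<phi>' t \<le> - c * \<phi> t"
  shows "\<phi> T \<le> exp (- c * T) * \<phi> 0"
proof -
  have "exp (c * T) * \<phi> T \<le> exp (c * 0) * \<phi> 0"
  proof (rule DERIV_nonpos_imp_decreasing_open[OF assms(1)])
    fix t assume t: "0 < t" "t < T"
    have "((\<lambda>t. exp (c * t) * \<phi> t) has_real_derivative
        exp (c * t) * (c * \<phi> t + \<phi>' t)) (at t)"
      using assms(3)[OF t] by (auto intro!: derivative_eq_intros simp: algebra_simps)
    moreover have "exp (c * t) * (c * \<phi> t + \<phi>' t) \<le> 0"
      using assms(4)[OF t] by (intro mult_nonneg_nonpos) auto
    ultimately show "\<exists>y. ((\<lambda>t. exp (c * t) * \<phi> t) has_real_derivative y) (at t) \<and> y \<le> 0"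
      by blast
  qed (auto intro!: continuous_intros assms)
  then show ?thesis by (simp add: exp_minus field_simps)
qed

text \<open>The level set of \<open>a\<close> is compact and nonempty, and its least element works:
  a value of at least \<open>a\<close> at an earlier time would force an earlier crossing. This
  serves continuation arguments, where a bound is known only until it first fails.\<close>

lemma first_hitting_time:
  fixes \<phi> :: "real \<Rightarrow> real"
  assumes "continuous_on {0..T} \<phi>" "\<phi> 0 < a" "t \<in> {0..T}" "\<phi> t \<ge> a"
  obtains t0 where "0 < t0" "t0 \<le> T" "\<phi> t0 = a" "\<And>s. 0 \<le> s \<Longrightarrow> s < t0 \<Longrightarrow> \<phi> s < a"
proof -
  have "\<exists>s\<ge>0. s \<le> t \<and> \<phi> s = a"
    using assms by (intro IVT') (auto elim: continuous_on_subset)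
  then obtain s1 where s1: "0 \<le> s1" "s1 \<le> t" "\<phi> s1 = a" by blast
  define S where "S = {s \<in> {0..T}. \<phi> s = a}"
  have "closed S"
    unfolding S_def using continuous_closed_preimage[OF assms(1) closed_atLeastAtMost closed_singleton[of a]]
    by (simp add: vimage_def Int_def)
  moreover have "s1 \<in> S" using s1 assms(3) by (simp add: S_def)
  ultimately have S: "compact S" "S \<noteq> {}"
    using bounded_subset[OF bounded_closed_interval[of 0 T], of S]
    by (auto simp: compact_eq_bounded_closed subset_iff S_def)
  then obtain t0 where t0: "t0 \<in> S" "\<And>s. s \<in> S \<Longrightarrow> t0 \<le> s"
    using compact_attains_inf[OF S] by blast
  show thesis
  proof
    show "0 < t0" "t0 \<le> T" "\<phi> t0 = a"
      using t0(1) assms(2) by (auto simp: S_def less_le)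
    fix s assume s: "0 \<le> s" "s < t0"
    show "\<phi> s < a"
    proof (rule ccontr)
      assume "\<not> \<phi> s < a"
      then have "\<exists>r\<ge>0. r \<le> s \<and> \<phi> r = a"
        using assms(1,2) s t0(1) by (intro IVT') (auto simp: S_def elim: continuous_on_subset)
      then show False using t0 s unfolding S_def by force
    qed
  qed
qed

section \<open>Uniform bounds for a continuous field of quadratic forms\<close>

text \<open>The form is homogeneous of degree 2 in \<open>v\<close>, so its minimum over
  \<open>K\<close> times the unit sphere suffices.\<close>

lemma compact_posdef_bounds:
  fixes P :: "'a::topological_space \<Rightarrow> real ^ 'n ^ 'n"
  assumes "compact K" "continuous_on K P" "\<And>x. x \<in> K \<Longrightarrow> posdef (P x)"
  obtains c where "c > 0" "\<And>x v. x \<in> K \<Longrightarrow> c * (norm v)\<^sup>2 \<le> qform (P x) v"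
proof (cases "K = {}")
  case True
  then show thesis using that[of 1] by simp
next
  case False
  let ?S = "K \<times> sphere (0 :: real ^ 'n) 1"
  have "continuous_on ?S (\<lambda>z. qform (P (fst z)) (snd z))"
    by (intro continuous_intros continuous_on_compose2[OF assms(2)]) auto
  moreover have "compact ?S" "?S \<noteq> {}"
    using False assms(1) by (auto simp: compact_Times)
  ultimately obtain z where z: "z \<in> ?S" "\<And>w. w \<in> ?S \<Longrightarrow> qform (P (fst z)) (snd z) \<le> qform (P (fst w)) (snd w)"
    using continuous_attains_inf[of ?S "\<lambda>z. qform (P (fst z)) (snd z)"] by blast
  show thesis
  proof
    have "snd z \<noteq> 0" using z(1) by (auto simp: mem_Times_iff)
    then show "qform (P (fst z)) (snd z) > 0"
      using z(1) assms(3) posdef_qform_pos by (auto simp: mem_Times_iff)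
    fix x v assume x: "x \<in> K"
    show "qform (P (fst z)) (snd z) * (norm v)\<^sup>2 \<le> qform (P x) v"
    proof (cases "v = 0")
      case False
      have "qform (P (fst z)) (snd z) \<le> qform (P x) (v /\<^sub>R norm v)"
        using z(2)[of "(x, v /\<^sub>R norm v)"] x False by simp
      also have "\<dots> = qform (P x) v / (norm v)\<^sup>2"
        by (simp add: power_inverse divide_inverse)
      finally show ?thesis using False by (simp add: field_simps)
    qed simp
  qed
qed

lemma sqrt_mult_norm_le_sqrt_qform:
  assumes "c > 0" "c * (norm v)\<^sup>2 \<le> qform M v"
  shows "sqrt c * norm v \<le> sqrt (qform M v)"
  using real_sqrt_le_mono[OF assms(2)] by (simp add: real_sqrt_mult)

text \<open>Continuity bounds the difference of the matrices in norm; the lower bound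
  \<open>c\<close> of the form at \<open>p\<close> turns this into an error relative to
  \<open>qform (P p) v\<close>, uniformly in \<open>v\<close>.\<close>

lemma posdef_comparison:
  fixes P :: "'a::metric_space \<Rightarrow> real ^ 'n ^ 'n"
  assumes "continuous_on UNIV P" "posdef (P p)" "k > 1"
  obtains \<delta> where "\<delta> > 0"
    "\<And>z v. dist z p < \<delta> \<Longrightarrow> sqrt (qform (P z) v) \<le> k * sqrt (qform (P p) v)"
    "\<And>z v. dist z p < \<delta> \<Longrightarrow> sqrt (qform (P p) v) \<le> k * sqrt (qform (P z) v)"
proof -
  obtain c where c: "c > 0" "\<And>v. c * (norm v)\<^sup>2 \<le> qform (P p) v"
    using compact_posdef_bounds[of "{p}" P] assms(2) by (metis compact_sing continuous_on_sing singletonD singletonI)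
  obtain K where K: "K > 0" "\<And>(M :: real ^ 'n ^ 'n) v. norm (M *v v) \<le> norm M * norm v * K"
    using matrix_vector_mult_norm_bound by blast
  \<comment> \<open>With this choice \<open>1 - \<epsilon>\<close> is exactly
    \<open>1 / k\<^sup>2\<close>, and \<open>1 + \<epsilon>\<close> is at most
    \<open>k\<^sup>2\<close> because \<open>k\<^sup>2 + 1 / k\<^sup>2\<close> is at least 2.\<close>
  define \<epsilon> where "\<epsilon> = 1 - 1 / k\<^sup>2"
  have k2: "k\<^sup>2 > 1" using assms(3) by (simp add: one_less_power)
  have \<epsilon>: "\<epsilon> > 0" using k2 by (simp add: \<epsilon>_def divide_less_eq)
  have k\<epsilon>: "1 + \<epsilon> \<le> k\<^sup>2" "k\<^sup>2 * (1 - \<epsilon>) = 1"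
  proof -
    have "0 \<le> (k\<^sup>2 - 1)\<^sup>2 / k\<^sup>2" by simp
    also have "\<dots> = k\<^sup>2 - (1 + \<epsilon>)"
      using assms(3) by (simp add: \<epsilon>_def field_simps power2_eq_square)
    finally show "1 + \<epsilon> \<le> k\<^sup>2" by simp
    show "k\<^sup>2 * (1 - \<epsilon>) = 1" using assms(3) by (simp add: \<epsilon>_def)
  qed
  have "\<epsilon> * c / K > 0" using \<epsilon> c(1) K(1) by simp
  then obtain \<delta> where \<delta>: "\<delta> > 0" "\<And>z. dist z p < \<delta> \<Longrightarrow> dist (P z) (P p) < \<epsilon> * c / K"
    using assms(1)[unfolded continuous_on_iff] by blast
  have close: "\<bar>qform (P z) v - qform (P p) v\<bar> \<le> \<epsilon> * qform (P p) v" if "dist z p < \<delta>" for z v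
  proof -
    have "\<bar>qform (P z) v - qform (P p) v\<bar> = \<bar>v \<bullet> ((P z - P p) *v v)\<bar>"
      by (simp add: qform_def matrix_vector_mult_diff_rdistrib inner_diff_right)
    also have "\<dots> \<le> norm v * (norm (P z - P p) * norm v * K)"
      using Cauchy_Schwarz_ineq2[of v "(P z - P p) *v v"] K(2)[of "P z - P p" v]
      by (meson mult_left_mono norm_ge_zero order_trans)
    also have "\<dots> \<le> norm v * ((\<epsilon> * c / K) * norm v * K)"
      using \<delta>(2)[OF that] K(1) by (intro mult_left_mono mult_right_mono) (auto simp: dist_norm)
    also have "\<dots> = \<epsilon> * (c * (norm v)\<^sup>2)" using K(1) by (simp add: power2_eq_square)
    also have "\<dots> \<le> \<epsilon> * qform (P p) v" using c(2) \<epsilon> by (intro mult_left_mono) auto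
    finally show ?thesis .
  qed
  have k_sqrt: "k * sqrt a = sqrt (k\<^sup>2 * a)" for a using assms(3) by (simp add: real_sqrt_mult)
  show thesis
  proof
    fix z v assume z: "dist z p < \<delta>"
    have nonneg: "qform (P p) v \<ge> 0" using assms(2) by simp
    have "qform (P z) v \<le> (1 + \<epsilon>) * qform (P p) v" using close[OF z, of v] by (simp add: algebra_simps)
    also have "\<dots> \<le> k\<^sup>2 * qform (P p) v" using k\<epsilon>(1) nonneg by (rule mult_right_mono)
    finally show "sqrt (qform (P z) v) \<le> k * sqrt (qform (P p) v)" by (simp add: k_sqrt)
    have "(1 - \<epsilon>) * qform (P p) v \<le> qform (P z) v" using close[OF z, of v] by (simp add: algebra_simps)
    then have "k\<^sup>2 * ((1 - \<epsilon>) * qform (P p) v) \<le> k\<^sup>2 * qform (P z) v" by (intro mult_left_mono) auto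
    then have "qform (P p) v \<le> k\<^sup>2 * qform (P z) v" using k\<epsilon>(2) by (simp add: mult.assoc[symmetric])
    then show "sqrt (qform (P p) v) \<le> k * sqrt (qform (P z) v)" by (simp add: k_sqrt)
  qed (rule \<delta>(1))
qed

section \<open>The geodesic distance\<close>

definition joins ::
  "(real ^ 'n \<Rightarrow> real ^ 'n ^ 'n) \<Rightarrow> (real \<Rightarrow> real ^ 'n) \<Rightarrow> real ^ 'n \<Rightarrow> real ^ 'n \<Rightarrow> real \<Rightarrow> bool" where
  "joins P \<gamma> x y L \<longleftrightarrow> valid_path \<gamma> \<and> pathstart \<gamma> = x \<and> pathfinish \<gamma> = y \<and>
     (speed P \<gamma> has_integral L) {0..1}"

lemma geodesic_dist_joins: "geodesic_dist P x y = Inf {L. \<exists>\<gamma>. joins P \<gamma> x y L}"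
  by (simp add: geodesic_dist_def joins_def)

lemma valid_path_finite_nondifferentiable:
  assumes "valid_path \<gamma>"
  obtains S where "finite S"
    "\<And>s. s \<in> {0..1} - S \<Longrightarrow> (\<gamma> has_vector_derivative vector_derivative \<gamma> (at s)) (at s)"
  using assms unfolding valid_path_def piecewise_C1_differentiable_on_def C1_differentiable_on_eq
  by (auto simp: vector_derivative_works)

lemma speed_eq:
  assumes "(\<gamma> has_vector_derivative v) (at s)"
  shows "speed P \<gamma> s = sqrt (qform (P (\<gamma> s)) v)"
  using assms by (simp add: speed_def qform_def vector_derivative_at)

section \<open>Reparametrisation, reversal and concatenation of curves\<close>

text \<open>\<open>speed\<close> contains the two-sided derivative, so \<open>\<eta>\<close> must
  agree with the reparametrised curve on an open set. The slopes used are -1 for reversal and 2 for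
  the halves of a concatenation.\<close>

lemma speed_affine:
  assumes "(\<gamma> has_vector_derivative v) (at (m * s + c))"
    and "open U" "s \<in> U" "\<And>r. r \<in> U \<Longrightarrow> \<eta> r = \<gamma> (m * r + c)"
  shows "speed P \<eta> s = \<bar>m\<bar> * speed P \<gamma> (m * s + c)"
proof -
  have "((\<lambda>r. m * r + c) has_vector_derivative m) (at s)"
    by (auto intro!: derivative_eq_intros simp: has_vector_derivative_def)
  from vector_diff_chain_at[OF this assms(1)]
  have "(\<eta> has_vector_derivative (m *\<^sub>R v)) (at s)"
    by (rule has_vector_derivative_transform_within_open[OF _ assms(2,3)]) (simp add: assms(4))
  then show ?thesis
    using assms(3,4) by (simp add: speed_eq[OF assms(1)] speed_eq real_sqrt_mult)
qed

lemma joins_reversepath: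
  assumes "joins P \<gamma> x y L"
  shows "joins P (reversepath \<gamma>) y x L"
proof -
  have vp: "valid_path \<gamma>" and L: "(speed P \<gamma> has_integral L) {0..1}"
    using assms by (auto simp: joins_def)
  obtain S where S: "finite S"
    "\<And>s. s \<in> {0..1} - S \<Longrightarrow> (\<gamma> has_vector_derivative vector_derivative \<gamma> (at s)) (at s)"
    using valid_path_finite_nondifferentiable[OF vp] by blast
  have "((\<lambda>s. speed P \<gamma> (1 - s)) has_integral L) {0..1}"
    using has_integral_affinity01[OF L, of "-1" 1] by simp
  then have "(speed P (reversepath \<gamma>) has_integral L) {0..1}"
  proof (rule has_integral_spike_finite[rotated 2])
    show "finite ((\<lambda>s. 1 - s) ` S)" using S(1) by simp
    fix s assume "s \<in> {0..1} - (\<lambda>s. 1 - s) ` S"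
    then have "1 - s \<in> {0..1} - S" by force
    from S(2)[OF this] show "speed P (reversepath \<gamma>) s = speed P \<gamma> (1 - s)"
      using speed_affine[of \<gamma> _ "-1" s 1 UNIV "reversepath \<gamma>" P] by (simp add: reversepath_def)
  qed
  then show ?thesis using assms by (simp add: joins_def)
qed

lemma joins_joinpaths:
  assumes "joins P \<gamma>1 x y L1" "joins P \<gamma>2 y z L2"
  shows "joins P (\<gamma>1 +++ \<gamma>2) x z (L1 + L2)"
proof -
  have vp: "valid_path \<gamma>1" "valid_path \<gamma>2"
    and L1: "(speed P \<gamma>1 has_integral L1) {0..1}" and L2: "(speed P \<gamma>2 has_integral L2) {0..1}"
    using assms by (auto simp: joins_def)
  obtain S1 where S1: "finite S1"
    "\<And>s. s \<in> {0..1} - S1 \<Longrightarrow> (\<gamma>1 has_vector_derivative vector_derivative \<gamma>1 (at s)) (at s)"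
    using valid_path_finite_nondifferentiable[OF vp(1)] by blast
  obtain S2 where S2: "finite S2"
    "\<And>s. s \<in> {0..1} - S2 \<Longrightarrow> (\<gamma>2 has_vector_derivative vector_derivative \<gamma>2 (at s)) (at s)"
    using valid_path_finite_nondifferentiable[OF vp(2)] by blast
  \<comment> \<open>The substitution with slope 2 halves the integral; the factor 2 restores
    it.\<close>
  have "((\<lambda>s. 2 * speed P \<gamma>1 (2 * s)) has_integral L1) {0..1/2}"
    using has_integral_mult_right[OF has_integral_affinity01[OF L1, of 2 0], of 2]
    by (simp only: image_affinity_atLeastAtMost_div_diff) simp
  then have I1: "(speed P (\<gamma>1 +++ \<gamma>2) has_integral L1) {0..1/2}"
  proof (rule has_integral_spike_finite[rotated 2])
    \<comment> \<open>The junction 1/2 is exceptional as well: the concatenation need not agree with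
      the rescaled first curve on a neighbourhood of it.\<close>
    show "finite (insert (1/2) ((\<lambda>s. s / 2) ` S1))" using S1(1) by simp
    fix s :: real assume s: "s \<in> {0..1/2} - insert (1/2) ((\<lambda>s. s / 2) ` S1)"
    moreover have "2 * s \<in> S1 \<Longrightarrow> s \<in> (\<lambda>s. s / 2) ` S1"
      by (rule image_eqI[of _ _ "2 * s"]) auto
    ultimately have "2 * s \<in> {0..1} - S1" by auto
    from S1(2)[OF this] s show "speed P (\<gamma>1 +++ \<gamma>2) s = 2 * speed P \<gamma>1 (2 * s)"
      using speed_affine[of \<gamma>1 _ 2 s 0 "{..<1/2}" "\<gamma>1 +++ \<gamma>2" P] by (simp add: joinpaths_def)
  qed
  have "((\<lambda>s. 2 * speed P \<gamma>2 (2 * s - 1)) has_integral L2) {1/2..1}"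
    using has_integral_mult_right[OF has_integral_affinity01[OF L2, of 2 "-1"], of 2]
    by (simp only: image_affinity_atLeastAtMost_div_diff) simp
  then have I2: "(speed P (\<gamma>1 +++ \<gamma>2) has_integral L2) {1/2..1}"
  proof (rule has_integral_spike_finite[rotated 2])
    show "finite (insert (1/2) ((\<lambda>s. (s + 1) / 2) ` S2))" using S2(1) by simp
    fix s :: real assume s: "s \<in> {1/2..1} - insert (1/2) ((\<lambda>s. (s + 1) / 2) ` S2)"
    moreover have "2 * s + - 1 \<in> S2 \<Longrightarrow> s \<in> (\<lambda>s. (s + 1) / 2) ` S2"
      by (rule image_eqI[of _ _ "2 * s + - 1"]) auto
    ultimately have "2 * s + - 1 \<in> {0..1} - S2" by auto
    from S2(2)[OF this] s show "speed P (\<gamma>1 +++ \<gamma>2) s = 2 * speed P \<gamma>2 (2 * s - 1)"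
      using speed_affine[of \<gamma>2 _ 2 s "-1" "{1/2<..}" "\<gamma>1 +++ \<gamma>2" P] by (simp add: joinpaths_def)
  qed
  have "(speed P (\<gamma>1 +++ \<gamma>2) has_integral (L1 + L2)) {0..1}"
    by (rule has_integral_combine[OF _ _ I1 I2]) auto
  then show ?thesis using assms by (simp add: joins_def valid_path_join)
qed

section \<open>Upper and lower bounds for lengths\<close>

locale metric_field =
  fixes P :: "real ^ 'n \<Rightarrow> real ^ 'n ^ 'n"
  assumes cont_P: "continuous_on UNIV P"
    and posdef_P: "posdef (P x)"
begin

lemma cont_P_on: "continuous_on S P"
  using cont_P continuous_on_subset by blast

lemma qform_P_nonneg [simp]: "qform (P x) v \<ge> 0"
  by (simp add: posdef_P)

lemma P_sym: "transpose (P x) = P x"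
  using posdef_P by (simp add: posdef_def)

lemma speed_nonneg [simp]: "speed P \<gamma> s \<ge> 0"
  using posdef_qform_nonneg[OF posdef_P] by (simp add: speed_def qform_def)

lemma joins_length_nonneg: "joins P \<gamma> x y L \<Longrightarrow> L \<ge> 0"
  unfolding joins_def by (auto intro: has_integral_nonneg)

text \<open>The endpoints go into the exceptional set, because solution curves have two-sided
  derivatives only at interior times. Continuity of \<open>\<gamma>'\<close> up to the endpoints
  gives integrability of the speed.\<close>

lemma joins_C1:
  assumes "continuous_on {0..1} \<gamma>" "continuous_on {0..1} \<gamma>'"
    and deriv: "\<And>s. 0 < s \<Longrightarrow> s < 1 \<Longrightarrow> (\<gamma> has_vector_derivative \<gamma>' s) (at s)"
    and bound: "\<And>s. 0 \<le> s \<Longrightarrow> s \<le> 1 \<Longrightarrow> sqrt (qform (P (\<gamma> s)) (\<gamma>' s)) \<le> B"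
  obtains L where "joins P \<gamma> (\<gamma> 0) (\<gamma> 1) L" "L \<le> B"
proof -
  let ?\<phi> = "\<lambda>s. sqrt (qform (P (\<gamma> s)) (\<gamma>' s))"
  have "\<gamma> C1_differentiable_on ({0..1} - {0, 1})"
    unfolding C1_differentiable_on_def
    using deriv by (intro exI[of _ \<gamma>']) (auto intro: continuous_on_subset[OF assms(2)])
  then have vp: "valid_path \<gamma>"
    using assms(1) unfolding valid_path_def piecewise_C1_differentiable_on_def
    by (intro conjI exI[of _ "{0, 1}"]) auto
  have "continuous_on {0..1} ?\<phi>"
    by (intro continuous_intros continuous_on_compose2[OF cont_P assms(1)] assms(2)) auto
  then obtain L where L: "(?\<phi> has_integral L) {0..1}"
    using integrable_continuous_real by blast
  then have "(speed P \<gamma> has_integral L) {0..1}"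
    by (rule has_integral_spike_finite[of "{0, 1}", rotated 2]) (auto simp: speed_eq deriv)
  moreover have "L \<le> B"
    using has_integral_le[OF L, of "\<lambda>_. B" B] bound has_integral_const_real[of B 0 1] by simp
  ultimately show thesis
    using vp by (intro that[of L]) (simp_all add: joins_def pathstart_def pathfinish_def)
qed

text \<open>The set under the infimum in \<open>geodesic_dist\<close> is thus nonempty, as lower
  bounds for \<open>Inf\<close> require; the straight segment is the witness.\<close>

lemma joins_exists: "\<exists>\<gamma> L. joins P \<gamma> x y L"
proof -
  have cont: "continuous_on {0..1} (\<lambda>s. sqrt (qform (P (linepath x y s)) (y - x)))"
    by (intro continuous_intros continuous_on_compose2[OF cont_P]) auto
  have "bounded ((\<lambda>s. sqrt (qform (P (linepath x y s)) (y - x))) ` {0..1})"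
    by (intro compact_imp_bounded compact_continuous_image cont) simp
  then obtain B where "\<forall>s \<in> {0..1}. \<bar>sqrt (qform (P (linepath x y s)) (y - x))\<bar> \<le> B"
    unfolding bounded_iff by auto
  then have "sqrt (qform (P (linepath x y s)) (y - x)) \<le> B" if "0 \<le> s" "s \<le> 1" for s
    using that by fastforce
  then show ?thesis
    using joins_C1[of "linepath x y" "\<lambda>_. y - x" B] has_vector_derivative_linepath_within
    by (metis continuous_on_const continuous_on_linepath linepath_0' linepath_1')
qed

lemma geodesic_dist_le: "joins P \<gamma> x y L \<Longrightarrow> geodesic_dist P x y \<le> L"
  unfolding geodesic_dist_joins
  by (rule cInf_lower) (auto intro!: bdd_belowI[of _ 0] elim: joins_length_nonneg)

lemma geodesic_dist_greatest:
  "(\<And>\<gamma> L. joins P \<gamma> x y L \<Longrightarrow> a \<le> L) \<Longrightarrow> a \<le> geodesic_dist P x y"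
  unfolding geodesic_dist_joins using joins_exists[of x y] by (intro cInf_greatest) auto

lemma geodesic_dist_le_segment:
  assumes "\<And>z. z \<in> closed_segment x y \<Longrightarrow> sqrt (qform (P z) (y - x)) \<le> B"
  shows "geodesic_dist P x y \<le> B"
proof -
  have "linepath x y s \<in> closed_segment x y" if "0 \<le> s" "s \<le> 1" for s
    using that path_image_linepath[of x y] by (auto simp: path_image_def)
  then obtain L where "joins P (linepath x y) (linepath x y 0) (linepath x y 1) L" "L \<le> B"
    using joins_C1[of "linepath x y" "\<lambda>_. y - x" B] has_vector_derivative_linepath_within assms
    by (metis continuous_on_const continuous_on_linepath)
  then show ?thesis using geodesic_dist_le by (fastforce simp: linepath_0' linepath_1')
qed

text \<open>Lengths are bounded below by calibration with a constant covector \<open>w\<close>.\<close>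

lemma inner_le_length:
  assumes "valid_path \<gamma>" "speed P \<gamma> integrable_on {0..1}" "0 \<le> a" "a \<le> b" "b \<le> 1"
    and w: "\<And>s v. a \<le> s \<Longrightarrow> s \<le> b \<Longrightarrow> w \<bullet> v \<le> sqrt (qform (P (\<gamma> s)) v)"
  shows "w \<bullet> (\<gamma> b - \<gamma> a) \<le> integral {a..b} (speed P \<gamma>)"
proof -
  obtain S where S: "finite S"
    "\<And>s. s \<in> {0..1} - S \<Longrightarrow> (\<gamma> has_vector_derivative vector_derivative \<gamma> (at s)) (at s)"
    using valid_path_finite_nondifferentiable[OF assms(1)] by blast
  have cont: "continuous_on {a..b} \<gamma>"
    using valid_path_imp_path[OF assms(1)] assms(3-5)
    by (auto simp: path_def elim: continuous_on_subset)
  have "((\<lambda>s. vector_derivative \<gamma> (at s)) has_integral (\<gamma> b - \<gamma> a)) {a..b}"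
    by (rule fundamental_theorem_of_calculus_strong[OF S(1) assms(4) S(2) cont]) (use assms(3-5) in auto)
  then have 1: "((\<lambda>s. w \<bullet> vector_derivative \<gamma> (at s)) has_integral (w \<bullet> (\<gamma> b - \<gamma> a))) {a..b}"
    using has_integral_linear[OF _ bounded_linear_inner_right[of w]] by (simp add: o_def)
  have "speed P \<gamma> integrable_on {a..b}"
    by (rule integrable_subinterval_real[OF assms(2)]) (use assms(3-5) in auto)
  then have 2: "(speed P \<gamma> has_integral integral {a..b} (speed P \<gamma>)) {a..b}"
    by (rule integrable_integral)
  show ?thesis
    by (rule has_integral_le[OF 1 2]) (use w in \<open>auto simp: speed_def qform_def\<close>)
qed

text \<open>One covector pairs with the chord to its full length in the form frozen at
  \<open>p\<close> and at the same time calibrates the arc. This is the lower bound on arc length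
  that the subdivision argument needs.\<close>

lemma chord_le_length:
  assumes "valid_path \<gamma>" "speed P \<gamma> integrable_on {0..1}" "0 \<le> a" "a \<le> b" "b \<le> 1" "k > 0"
    and k: "\<And>s v. a \<le> s \<Longrightarrow> s \<le> b \<Longrightarrow> sqrt (qform (P p) v) \<le> k * sqrt (qform (P (\<gamma> s)) v)"
  shows "sqrt (qform (P p) (\<gamma> b - \<gamma> a)) \<le> k * integral {a..b} (speed P \<gamma>)"
proof -
  let ?e = "\<gamma> b - \<gamma> a"
  define N where "N = sqrt (qform (P p) ?e)"
  have int: "speed P \<gamma> integrable_on {a..b}"
    by (rule integrable_subinterval_real[OF assms(2)]) (use assms(3-5) in auto)
  show ?thesis
  proof (cases "N = 0")
    case True
    then show ?thesis
      using integral_nonneg[OF int] assms(6) by (simp add: N_def)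
  next
    case False
    have N: "N > 0" using False by (simp add: N_def less_le posdef_P)
    \<comment> \<open>The dual of the chord in the form at \<open>p\<close>, normalised by
      \<open>N\<close>; the division by \<open>k\<close> pays for replacing \<open>P p\<close> by
      \<open>P (\<gamma> s)\<close>.\<close>
    define w where "w = (1 / (k * N)) *\<^sub>R (P p *v ?e)"
    have "w \<bullet> ?e \<le> integral {a..b} (speed P \<gamma>)"
    proof (rule inner_le_length[OF assms(1-5)])
      fix s v assume s: "a \<le> s" "s \<le> b"
      have "(P p *v ?e) \<bullet> v \<le> sqrt (qform (P p) v) * N"
        unfolding N_def using posdef_Cauchy_Schwarz[OF posdef_P[of p], of v ?e]
        by (simp add: inner_commute)
      also have "\<dots> \<le> (k * sqrt (qform (P (\<gamma> s)) v)) * N"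
        using k[OF s] N by (intro mult_right_mono) auto
      finally show "w \<bullet> v \<le> sqrt (qform (P (\<gamma> s)) v)"
        using N assms(6) by (simp add: w_def field_simps)
    qed
    moreover have "?e \<bullet> (P p *v ?e) = N\<^sup>2"
      unfolding N_def by (simp flip: qform_def)
    then have "w \<bullet> ?e = (1 / (k * N)) * N\<^sup>2"
      unfolding w_def by (metis inner_commute inner_scaleR_right)
    ultimately show ?thesis
      unfolding N_def[symmetric] using N assms(6) by (simp add: field_simps power2_eq_square)
  qed
qed

text \<open>The bound \<open>c\<close> holds only on the ball, so the curve is cut when it first
  reaches distance \<open>\<rho>\<close> from \<open>x\<close>; until then it stays in the ball, and
  the rest only adds length.\<close>

lemma length_ge_escape:
  assumes \<gamma>: "joins P \<gamma> x y L"
    and c: "c > 0" "\<And>z v. z \<in> cball x r \<Longrightarrow> c * (norm v)\<^sup>2 \<le> qform (P z) v"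
    and \<rho>: "0 < \<rho>" "\<rho> \<le> r" "\<rho> \<le> norm (y - x)"
  shows "sqrt c * \<rho> \<le> L"
proof -
  have vp: "valid_path \<gamma>" and ends: "\<gamma> 0 = x" "\<gamma> 1 = y"
    and L: "(speed P \<gamma> has_integral L) {0..1}"
    using \<gamma> by (auto simp: joins_def pathstart_def pathfinish_def)
  have "continuous_on {0..1} (\<lambda>s. norm (\<gamma> s - x))"
    using valid_path_imp_path[OF vp] by (auto simp: path_def intro!: continuous_intros)
  then obtain t where t: "0 < t" "t \<le> 1" "norm (\<gamma> t - x) = \<rho>"
    "\<And>s. 0 \<le> s \<Longrightarrow> s < t \<Longrightarrow> norm (\<gamma> s - x) < \<rho>"
    using first_hitting_time[of 1 "\<lambda>s. norm (\<gamma> s - x)" \<rho> 1] \<rho> ends by auto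
  \<comment> \<open>A covector of norm \<open>sqrt c\<close> towards the exit point: its pairing
    with a velocity stays below the speed wherever the bound by \<open>c\<close> applies.\<close>
  define w where "w = (sqrt c / \<rho>) *\<^sub>R (\<gamma> t - x)"
  have normw: "norm w = sqrt c" using t(3) \<rho>(1) c(1) by (simp add: w_def)
  have "w \<bullet> (\<gamma> t - \<gamma> 0) = (sqrt c / \<rho>) * \<rho>\<^sup>2"
    using t(3) by (simp add: w_def ends power2_norm_eq_inner flip: t(3))
  then have eq: "w \<bullet> (\<gamma> t - \<gamma> 0) = sqrt c * \<rho>" using \<rho>(1) by (simp add: power2_eq_square)
  have "w \<bullet> (\<gamma> t - \<gamma> 0) \<le> integral {0..t} (speed P \<gamma>)"
  proof (rule inner_le_length[OF vp])
    show "speed P \<gamma> integrable_on {0..1}" using L by blast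
    fix s v assume s: "0 \<le> s" "s \<le> t"
    have "norm (\<gamma> s - x) \<le> \<rho>" using t(3) t(4)[of s] s by (cases "s = t") auto
    then have "\<gamma> s \<in> cball x r" using \<rho>(2) by (simp add: dist_norm norm_minus_commute)
    then have "sqrt c * norm v \<le> sqrt (qform (P (\<gamma> s)) v)"
      using c by (intro sqrt_mult_norm_le_sqrt_qform) auto
    then show "w \<bullet> v \<le> sqrt (qform (P (\<gamma> s)) v)"
      using norm_cauchy_schwarz[of w v] normw by simp
  qed (use t in auto)
  also have "\<dots> \<le> integral {0..1} (speed P \<gamma>)"
    using L t(2) by (intro integral_subset_le) (auto intro: integrable_subinterval_real)
  also have "\<dots> = L" using L by (rule integral_unique)
  finally show ?thesis using eq by simp
qed

section \<open>The geodesic distance as a metric, and its topology\<close>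

text \<open>A curve that reaches distance \<open>\<eta>\<close> from \<open>x\<close> has length at
  least \<open>sqrt c * \<eta>\<close>. This separates points and turns limits in the geodesic
  distance into limits in norm.\<close>

lemma geodesic_dist_small_imp_close:
  assumes "\<eta> > 0"
  obtains \<epsilon> where "\<epsilon> > 0" "\<And>y. geodesic_dist P x y < \<epsilon> \<Longrightarrow> dist x y < \<eta>"
proof -
  obtain c where c: "c > 0" "\<And>z v. z \<in> cball x \<eta> \<Longrightarrow> c * (norm v)\<^sup>2 \<le> qform (P z) v"
    using compact_posdef_bounds[of "cball x \<eta>" P] cont_P_on posdef_P by (metis compact_cball)
  show thesis
  proof
    show "sqrt c * \<eta> > 0" using c(1) assms by simp
    fix y assume small: "geodesic_dist P x y < sqrt c * \<eta>"
    show "dist x y < \<eta>"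
    proof (rule ccontr)
      assume "\<not> dist x y < \<eta>"
      then have "\<eta> \<le> norm (y - x)" by (simp add: dist_norm norm_minus_commute)
      then have "sqrt c * \<eta> \<le> geodesic_dist P x y"
        using length_ge_escape[OF _ c assms] by (intro geodesic_dist_greatest) auto
      then show False using small by simp
    qed
  qed
qed

lemma geodesic_dist_nonneg [simp]: "geodesic_dist P x y \<ge> 0"
  by (intro geodesic_dist_greatest joins_length_nonneg)

lemma geodesic_dist_commute: "geodesic_dist P x y = geodesic_dist P y x"
  by (meson antisym geodesic_dist_greatest geodesic_dist_le joins_reversepath)

text \<open>The two infima are taken one after the other, each time with the remaining term moved to
  the left.\<close>

lemma geodesic_dist_triangle: "geodesic_dist P x z \<le> geodesic_dist P x y + geodesic_dist P y z"
proof -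
  have "geodesic_dist P x z - L1 \<le> L2" if "joins P \<gamma>1 x y L1" "joins P \<gamma>2 y z L2" for \<gamma>1 \<gamma>2 L1 L2
    using geodesic_dist_le[OF joins_joinpaths[OF that]] by simp
  then have "geodesic_dist P x z - L1 \<le> geodesic_dist P y z" if "joins P \<gamma>1 x y L1" for \<gamma>1 L1
    using that by (blast intro: geodesic_dist_greatest)
  then have "geodesic_dist P x z - geodesic_dist P y z \<le> geodesic_dist P x y"
    by (intro geodesic_dist_greatest) (auto simp: algebra_simps)
  then show ?thesis by simp
qed

lemma geodesic_dist_self [simp]: "geodesic_dist P x x = 0"
  using geodesic_dist_le_segment[of x x 0] geodesic_dist_nonneg[of x x] by simp

lemma geodesic_dist_eq_0 [simp]: "geodesic_dist P x y = 0 \<longleftrightarrow> x = y"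
proof
  assume "geodesic_dist P x y = 0"
  then have "dist x y < \<eta>" if "\<eta> > 0" for \<eta>
    using geodesic_dist_small_imp_close[OF that, of x] by metis
  then show "x = y" by (meson dist_pos_lt less_irrefl)
qed simp

lemma Metric_space_geodesic_dist: "Metric_space UNIV (geodesic_dist P)"
  by unfold_locales (auto simp: geodesic_dist_commute geodesic_dist_triangle)

lemma geodesic_dist_tendsto_0_imp_tendsto:
  assumes "((\<lambda>i. geodesic_dist P (\<sigma> i) p) \<longlongrightarrow> 0) F"
  shows "(\<sigma> \<longlongrightarrow> p) F"
  unfolding tendsto_iff
proof (intro allI impI)
  fix \<eta> :: real assume "\<eta> > 0"
  then obtain \<epsilon> where \<epsilon>: "\<epsilon> > 0" "\<And>y. geodesic_dist P p y < \<epsilon> \<Longrightarrow> dist p y < \<eta>"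
    using geodesic_dist_small_imp_close by blast
  from order_tendstoD(2)[OF assms \<epsilon>(1)]
  show "\<forall>\<^sub>F i in F. dist (\<sigma> i) p < \<eta>"
    by (rule eventually_mono) (metis \<epsilon>(2) geodesic_dist_commute dist_commute)
qed

text \<open>The limit is delivered in norm, because local existence and the continuity of the field
  are stated there.\<close>

lemma complete_metricD:
  fixes \<sigma> :: "nat \<Rightarrow> real ^ 'n"
  assumes "complete_metric P"
    and "\<And>\<epsilon>. \<epsilon> > 0 \<Longrightarrow> \<exists>N. \<forall>m\<ge>N. \<forall>n\<ge>N. geodesic_dist P (\<sigma> m) (\<sigma> n) < \<epsilon>"
  obtains p where "\<sigma> \<longlonglongrightarrow> p"
proof -
  interpret Metric_space UNIV "geodesic_dist P" by (rule Metric_space_geodesic_dist)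
  have "MCauchy \<sigma>" using assms(2) by (auto simp: MCauchy_def)
  then obtain p where "limitin mtopology \<sigma> p sequentially"
    using assms(1) by (auto simp: complete_metric_def mcomplete_def)
  then have "(\<lambda>n. geodesic_dist P (\<sigma> n) p) \<longlonglongrightarrow> 0"
    by (simp add: limitin_metric_dist_null)
  then show thesis using that geodesic_dist_tendsto_0_imp_tendsto by blast
qed

end

section \<open>Solutions of autonomous differential equations\<close>

text \<open>A finite horizon with one-sided derivatives at both ends, so that solutions can be
  restricted, shifted and glued before global existence is known.\<close>

definition solves :: "('a::real_normed_vector \<Rightarrow> 'a) \<Rightarrow> (real \<Rightarrow> 'a) \<Rightarrow> real \<Rightarrow> bool" where
  "solves g x T \<longleftrightarrow> (\<forall>t\<in>{0..T}. (x has_vector_derivative g (x t)) (at t within {0..T}))"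

lemma solves_continuous_on: "solves g x T \<Longrightarrow> continuous_on {0..T} x"
  unfolding solves_def continuous_on_eq_continuous_within
  by (blast intro: has_vector_derivative_continuous)

lemma solves_has_vector_derivative:
  assumes "solves g x T" "0 < t" "t < T"
  shows "(x has_vector_derivative g (x t)) (at t)"
proof -
  have "(x has_vector_derivative g (x t)) (at t within {0..T})"
    using assms by (simp add: solves_def)
  then show ?thesis using at_within_Icc_at[of 0 t T] assms(2,3) by simp
qed

lemma solves_mono: "solves g x T \<Longrightarrow> S \<le> T \<Longrightarrow> solves g x S"
  unfolding solves_def by (auto intro: has_vector_derivative_within_subset[where S = "{0..T}"])

lemma solves_cong:
  assumes "solves g x T" "\<And>t. 0 \<le> t \<Longrightarrow> t \<le> T \<Longrightarrow> y t = x t"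
  shows "solves g y T"
  unfolding solves_def
proof
  fix t assume t: "t \<in> {0..T}"
  have "(x has_vector_derivative g (y t)) (at t within {0..T})"
    using assms t by (simp add: solves_def)
  then show "(y has_vector_derivative g (y t)) (at t within {0..T})"
    by (rule has_vector_derivative_transform[OF t, rotated]) (use assms(2) in auto)
qed

lemma solves_shift:
  assumes "solves g x T" "0 \<le> a" "a \<le> T"
  shows "solves g (\<lambda>t. x (t + a)) (T - a)"
  unfolding solves_def
proof
  fix t assume t: "t \<in> {0..T - a}"
  have 1: "((\<lambda>t. t + a) has_vector_derivative 1) (at t within {0..T - a})"
    by (auto intro!: derivative_eq_intros)
  have 2: "(x has_vector_derivative g (x (t + a))) (at (t + a) within (\<lambda>t. t + a) ` {0..T - a})"
  proof (rule has_vector_derivative_within_subset)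
    show "(x has_vector_derivative g (x (t + a))) (at (t + a) within {0..T})"
      using assms t by (simp add: solves_def)
  qed (use assms(2) in auto)
  show "((\<lambda>t. x (t + a)) has_vector_derivative g (x (t + a))) (at t within {0..T - a})"
    using vector_diff_chain_within[OF 1 2] by (simp add: o_def)
qed

lemma solves_append:
  assumes "solves g x a" "solves g y b" "y 0 = x a" "0 \<le> a" "0 \<le> b"
  shows "solves g (\<lambda>t. if t \<in> {0..a} then x t else y (t - a)) (a + b)"
  unfolding solves_def
proof
  fix t assume t: "t \<in> {0..a + b}"
  \<comment> \<open>The closures meet only in \<open>a\<close>, which lies in both halves, so
    derivatives within the halves suffice; at \<open>a\<close> they agree because
    \<open>y 0 = x a\<close>.\<close>
  have closures: "{0..a} \<union> (closure {0..a} \<inter> closure {a..a + b}) = {0..a}"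
    "{a..a + b} \<union> (closure {0..a} \<inter> closure {a..a + b}) = {a..a + b}"
    using assms(4,5) by auto
  have "((\<lambda>t. if t \<in> {0..a} then x t else y (t - a)) has_vector_derivative
      (if t \<in> {0..a} then g (x t) else g (y (t - a)))) (at t within {0..a + b})"
  proof (rule has_vector_derivative_If_within_closures[where T = "{a..a + b}"], unfold closures)
    assume t: "t \<in> {a..a + b}"
    have 1: "((\<lambda>t. t - a) has_vector_derivative 1) (at t within {a..a + b})"
      by (auto intro!: derivative_eq_intros)
    have 2: "(y has_vector_derivative g (y (t - a))) (at (t - a) within (\<lambda>t. t - a) ` {a..a + b})"
    proof (rule has_vector_derivative_within_subset)
      show "(y has_vector_derivative g (y (t - a))) (at (t - a) within {0..b})"
        using assms(2) t by (simp add: solves_def)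
    qed auto
    show "((\<lambda>t. y (t - a)) has_vector_derivative g (y (t - a))) (at t within {a..a + b})"
      using vector_diff_chain_within[OF 1 2] by (simp add: o_def)
  qed (use t assms in \<open>auto simp: solves_def\<close>)
  then show "((\<lambda>t. if t \<in> {0..a} then x t else y (t - a)) has_vector_derivative
      g (if t \<in> {0..a} then x t else y (t - a))) (at t within {0..a + b})"
    by (simp only: if_distrib[of g])
qed

lemma solves_all_imp_derivative:
  assumes "\<And>T. T \<ge> 0 \<Longrightarrow> solves g x T" "t \<ge> 0"
  shows "(x has_vector_derivative g (x t)) (at t within {0..})"
proof -
  \<comment> \<open>The horizon \<open>t + 1\<close> keeps \<open>t\<close> away from the right end,
    so that near \<open>t\<close> the interval coincides with \<open>{0..}\<close>.\<close>
  have "(x has_vector_derivative g (x t)) (at t within {0..t + 1})"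
    using assms by (simp add: solves_def)
  moreover have "at t within {0..t + 1} = at t within {0..}"
    by (rule at_within_nhd[of _ "{..<t + 1}"]) (use assms(2) in auto)
  ultimately show ?thesis by simp
qed

section \<open>C1 fields: Lipschitz bound, uniform linearisation, local existence\<close>

lemma C1_Lipschitz_on_cball:
  fixes g :: "'a::euclidean_space \<Rightarrow> 'b::real_normed_vector" and A :: "'a \<Rightarrow> 'a \<Rightarrow>\<^sub>L 'b"
  assumes "\<And>x. (g has_derivative blinfun_apply (A x)) (at x)" "continuous_on UNIV A"
  obtains B where "B > 0"
    "\<And>x y. x \<in> cball p r \<Longrightarrow> y \<in> cball p r \<Longrightarrow> norm (g x - g y) \<le> B * norm (x - y)"
proof -
  have "bounded (A ` cball p r)"
    by (intro compact_imp_bounded compact_continuous_image continuous_on_subset[OF assms(2)]) auto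
  then obtain B where B: "B > 0" "\<And>x. x \<in> cball p r \<Longrightarrow> norm (A x) \<le> B"
    unfolding bounded_pos by auto
  show thesis
  proof (rule that[OF B(1)])
    fix x y assume "x \<in> cball p r" "y \<in> cball p r"
    then show "norm (g x - g y) \<le> B * norm (x - y)"
      using differentiable_bound[of "cball p r" g "\<lambda>x. blinfun_apply (A x)" B x y]
        has_derivative_at_withinI[OF assms(1)] B(2)
      by (simp add: norm_blinfun.rep_eq)
  qed
qed

text \<open>Uniform continuity of \<open>A\<close> on a ball containing the unit neighbourhood of
  \<open>K\<close> makes \<open>\<delta>\<close> independent of \<open>x\<close>; capping it at 1
  keeps the segments inside that ball.\<close>

lemma C1_uniform_linearization:
  fixes g :: "'a::euclidean_space \<Rightarrow> 'b::real_normed_vector" and A :: "'a \<Rightarrow> 'a \<Rightarrow>\<^sub>L 'b"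
  assumes "\<And>x. (g has_derivative blinfun_apply (A x)) (at x)" "continuous_on UNIV A"
    and "compact K" "\<epsilon> > 0"
  obtains \<delta> where "\<delta> > 0"
    "\<And>x y. x \<in> K \<Longrightarrow> dist y x < \<delta> \<Longrightarrow> norm (g y - g x - A x (y - x)) \<le> \<epsilon> * norm (y - x)"
proof -
  obtain R where R: "\<And>x. x \<in> K \<Longrightarrow> norm x \<le> R"
    using compact_imp_bounded[OF assms(3)] by (auto simp: bounded_iff)
  have "uniformly_continuous_on (cball 0 (R + 1)) A"
    by (intro compact_uniformly_continuous continuous_on_subset[OF assms(2)]) auto
  then obtain d where d: "d > 0"
    "\<And>x y. x \<in> cball 0 (R + 1) \<Longrightarrow> y \<in> cball 0 (R + 1) \<Longrightarrow> dist y x < d \<Longrightarrow> dist (A y) (A x) < \<epsilon>"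
    unfolding uniformly_continuous_on_def using assms(4) by metis
  show thesis
  proof
    show "min d 1 > 0" using d(1) by simp
    fix x y assume x: "x \<in> K" and y: "dist y x < min d 1"
    have near: "z \<in> cball 0 (R + 1)" if "z \<in> ball x (min d 1)" for z
      using that R[OF x] norm_triangle_sub[of z x] by (simp add: dist_norm norm_minus_commute)
    have "norm (g y - g x - A x (y - x)) \<le> norm (y - x) * \<epsilon>"
    proof (rule differentiable_bound_linearization[where S = "ball x (min d 1)"
          and f' = "\<lambda>z. blinfun_apply (A z)"])
      fix z assume z: "z \<in> ball x (min d 1)"
      show "(g has_derivative blinfun_apply (A z)) (at z within ball x (min d 1))"
        by (rule has_derivative_at_withinI[OF assms(1)])
      have "dist (A z) (A x) < \<epsilon>"
        using z x near[OF z] near[of x] d by (intro d(2)) (auto simp: dist_commute)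
      then show "onorm (blinfun_apply (A z) - blinfun_apply (A x)) \<le> \<epsilon>"
        by (simp add: dist_norm norm_blinfun.rep_eq minus_blinfun.rep_eq fun_diff_def)
    next
      fix t :: real assume "t \<in> {0..1}"
      then have "\<bar>t\<bar> * norm (y - x) \<le> 1 * norm (y - x)" by (intro mult_right_mono) auto
      also have "\<dots> < min d 1" using y by (simp add: dist_norm)
      finally show "x + t *\<^sub>R (y - x) \<in> ball x (min d 1)" by (simp add: dist_norm)
    qed (use d in auto)
    then show "norm (g y - g x - A x (y - x)) \<le> \<epsilon> * norm (y - x)" by (simp add: mult.commute)
  qed
qed

text \<open>Picard iteration for the vector field cut off by the projection onto a ball.\<close>

lemma local_solution:
  fixes g :: "'a::euclidean_space \<Rightarrow> 'a" and A :: "'a \<Rightarrow> 'a \<Rightarrow>\<^sub>L 'a"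
  assumes "\<And>x. (g has_derivative blinfun_apply (A x)) (at x)" "continuous_on UNIV A"
  obtains \<tau> where "\<tau> > 0" "\<And>z. dist z p \<le> 1 \<Longrightarrow> \<exists>x. solves g x \<tau> \<and> x 0 = z"
proof -
  \<comment> \<open>Radius 2 leaves room for starting points within 1 of \<open>p\<close> that
    travel a distance of at most 1; hence one \<open>\<tau>\<close> serves them all.\<close>
  obtain B where B: "B > 0"
    "\<And>x y. x \<in> cball p 2 \<Longrightarrow> y \<in> cball p 2 \<Longrightarrow> norm (g x - g y) \<le> B * norm (x - y)"
    using C1_Lipschitz_on_cball[OF assms] by blast
  have contg: "continuous_on S g" for S
    using assms(1) by (meson continuous_at_imp_continuous_on has_derivative_continuous)
  have "bounded (g ` cball p 2)"
    by (intro compact_imp_bounded compact_continuous_image contg) simp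
  then obtain M where M: "M > 0" "\<And>x. x \<in> cball p 2 \<Longrightarrow> norm (g x) \<le> M"
    unfolding bounded_pos by auto
  define \<pi> where "\<pi> = closest_point (cball p 2)"
  have cball: "convex (cball p 2)" "closed (cball p 2)" "cball p 2 \<noteq> {}" by auto
  have \<pi>: "\<pi> x \<in> cball p 2" for x
    unfolding \<pi>_def by (rule closest_point_in_set[OF cball(2,3)])
  have \<pi>_self: "\<pi> x = x" if "x \<in> cball p 2" for x
    unfolding \<pi>_def using that by (rule closest_point_self)
  define G where "G = g \<circ> \<pi>"
  have G_bound: "norm (G x) \<le> M" for x using M(2)[OF \<pi>] by (simp add: G_def)
  have G_Lip: "norm (G x - G y) \<le> B * dist x y" for x y
  proof -
    have "norm (G x - G y) \<le> B * dist (\<pi> x) (\<pi> y)"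
      using B(2)[OF \<pi> \<pi>] by (simp add: G_def dist_norm)
    also have "\<dots> \<le> B * dist x y"
      unfolding \<pi>_def using closest_point_lipschitz[OF cball] B(1) by (intro mult_left_mono) auto
    finally show ?thesis .
  qed
  have contG: "continuous_on UNIV G"
    unfolding G_def \<pi>_def
    by (intro continuous_on_compose continuous_on_closest_point[OF cball] contg)
  \<comment> \<open>The first bound makes the Picard operator contract by 1/2, the second keeps the
    solution within 1 of its starting point.\<close>
  define \<tau> where "\<tau> = min (1 / (2 * B)) (1 / M)"
  have \<tau>: "\<tau> > 0" "\<tau> * B \<le> 1 / 2" "\<tau> * M \<le> 1"
    using B(1) M(1) by (auto simp: \<tau>_def min_def field_simps)
  \<comment> \<open>Freezing time outside \<open>{0..\<tau>}\<close> turns the iterates into bounded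
    continuous functions on the whole line, a complete space to which the fixed point theorem
    applies.\<close>
  define clip where "clip t = max 0 (min \<tau> t)" for t
  have clip: "0 \<le> clip t" "clip t \<le> \<tau>" for t using \<tau>(1) by (auto simp: clip_def)
  have clip_self: "clip t = t" if "0 \<le> t" "t \<le> \<tau>" for t using that by (simp add: clip_def)
  show thesis
  proof (rule that[OF \<tau>(1)])
    fix z assume z: "dist z p \<le> 1"
    define \<Phi> where "\<Phi> u = (\<lambda>t. z + integral {0..clip t} (\<lambda>s. G (apply_bcontfun u s)))"
      for u :: "real \<Rightarrow>\<^sub>C 'a"
    have contGu: "continuous_on S (\<lambda>s. G (apply_bcontfun u s))" for S and u :: "real \<Rightarrow>\<^sub>C 'a"
      by (rule continuous_on_compose2[OF contG continuous_on_apply_bcontfun]) auto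
    have \<Phi>_bcont: "\<Phi> u \<in> bcontfun" for u
    proof -
      define J where "J s = z + integral {0..s} (\<lambda>s. G (apply_bcontfun u s))" for s
      have J: "continuous_on {0..\<tau>} J"
        unfolding J_def
        by (intro continuous_intros indefinite_integral_continuous_1 integrable_continuous_real contGu)
      have "continuous_on UNIV clip" unfolding clip_def by (intro continuous_intros)
      then have "continuous_on UNIV (\<lambda>t. J (clip t))"
        using clip by (intro continuous_on_compose2[OF J]) auto
      moreover have "bounded (range (\<lambda>t. J (clip t)))"
        using clip by (intro bounded_subset[OF compact_imp_bounded[OF compact_continuous_image[OF J]]]) auto
      ultimately show ?thesis by (simp add: bcontfun_def \<Phi>_def J_def)
    qed
    have "\<exists>!u. Bcontfun (\<Phi> u) = u"
    proof (rule banach_fix_type[of "1/2"]; (intro allI)?)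
      fix u v :: "real \<Rightarrow>\<^sub>C 'a"
      show "dist (Bcontfun (\<Phi> u)) (Bcontfun (\<Phi> v)) \<le> 1 / 2 * dist u v"
      proof (rule dist_bound)
        fix t
        have "dist (\<Phi> u t) (\<Phi> v t) =
            norm (integral {0..clip t} (\<lambda>s. G (apply_bcontfun u s) - G (apply_bcontfun v s)))"
          by (simp add: \<Phi>_def dist_norm integral_diff integrable_continuous_real contGu)
        also have "\<dots> \<le> (B * dist u v) * (clip t - 0)"
        proof (rule integral_bound)
          fix s
          have "norm (G (apply_bcontfun u s) - G (apply_bcontfun v s)) \<le> B * dist (apply_bcontfun u s) (apply_bcontfun v s)"
            by (rule G_Lip)
          also have "\<dots> \<le> B * dist u v" using B(1) dist_bounded by (intro mult_left_mono) auto
          finally show "norm (G (apply_bcontfun u s) - G (apply_bcontfun v s)) \<le> B * dist u v" .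
        qed (auto intro!: clip continuous_intros contGu)
        also have "\<dots> = (clip t * B) * dist u v" by simp
        also have "\<dots> \<le> (\<tau> * B) * dist u v"
          using clip B(1) by (intro mult_right_mono) auto
        also have "\<dots> \<le> 1 / 2 * dist u v" using \<tau>(2) by (intro mult_right_mono) auto
        finally show "dist (apply_bcontfun (Bcontfun (\<Phi> u)) t) (apply_bcontfun (Bcontfun (\<Phi> v)) t) \<le> 1 / 2 * dist u v"
          by (simp add: Bcontfun_inverse[OF \<Phi>_bcont])
      qed
    qed auto
    then obtain u where u: "Bcontfun (\<Phi> u) = u" by blast
    define x where "x = apply_bcontfun u"
    have "x = \<Phi> u" using u Bcontfun_inverse[OF \<Phi>_bcont, of u] by (simp add: x_def)
    then have x: "x t = z + integral {0..t} (\<lambda>s. G (x s))" if "0 \<le> t" "t \<le> \<tau>" for t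
      using that fun_cong[OF \<open>x = \<Phi> u\<close>, of t] unfolding \<Phi>_def
      by (simp only: clip_self flip: x_def)
    have contGx: "continuous_on S (\<lambda>s. G (x s))" for S unfolding x_def by (rule contGu)
    \<comment> \<open>The curve moves by at most \<open>\<tau> * M\<close>, so it never leaves the
      ball on which the projection is the identity.\<close>
    have Gx: "G (x t) = g (x t)" if t: "0 \<le> t" "t \<le> \<tau>" for t
    proof -
      have "norm (integral {0..t} (\<lambda>s. G (x s))) \<le> M * (t - 0)"
        by (rule integral_bound) (auto intro: t contGx G_bound)
      also have "\<dots> \<le> \<tau> * M" using t M(1) by (simp add: mult.commute)
      finally have "norm (x t - z) \<le> 1" using x[OF t] \<tau>(3) by simp
      then have "x t \<in> cball p 2"
        using z dist_triangle[of p "x t" z] by (simp add: dist_norm norm_minus_commute)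
      then show ?thesis by (simp add: G_def \<pi>_self)
    qed
    have "solves g x \<tau>"
      unfolding solves_def
    proof
      fix t assume t: "t \<in> {0..\<tau>}"
      have "((\<lambda>t. z + integral {0..t} (\<lambda>s. G (x s))) has_vector_derivative (0 + G (x t))) (at t within {0..\<tau>})"
        by (intro has_vector_derivative_add has_vector_derivative_const
            integral_has_vector_derivative contGx t)
      then have "(x has_vector_derivative (0 + G (x t))) (at t within {0..\<tau>})"
        by (rule has_vector_derivative_transform[OF t, rotated]) (auto simp: x)
      then show "(x has_vector_derivative g (x t)) (at t within {0..\<tau>})" using t by (simp add: Gx)
    qed
    moreover have "x 0 = z" using x[of 0] \<tau>(1) by simp
    ultimately show "\<exists>x. solves g x \<tau> \<and> x 0 = z" by blast
  qed
qed

section \<open>Contracting vector fields\<close>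

text \<open>The Loewner inequality tested on a vector: the two Jacobian terms coincide by symmetry
  of \<open>P x\<close>, whence the factor 2, and \<open>P' x (g x)\<close> is the derivative of the
  metric along the field.\<close>

locale contracting_field = metric_field P for P :: "real ^ 'n \<Rightarrow> real ^ 'n ^ 'n" +
  fixes g :: "real ^ 'n \<Rightarrow> real ^ 'n"
    and A :: "real ^ 'n \<Rightarrow> (real ^ 'n) \<Rightarrow>\<^sub>L (real ^ 'n)"
    and P' :: "real ^ 'n \<Rightarrow> (real ^ 'n) \<Rightarrow>\<^sub>L (real ^ 'n ^ 'n)"
    and \<alpha> :: real
  assumes deriv_g: "(g has_derivative blinfun_apply (A x)) (at x)"
    and cont_A: "continuous_on UNIV A"
    and deriv_P: "(P has_derivative blinfun_apply (P' x)) (at x)"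
    and \<alpha>_pos: "\<alpha> > 0"
    and contraction:
      "2 * (A x v \<bullet> (P x *v v)) + qform (P' x (g x)) v \<le> - 2 * \<alpha> * qform (P x) v"
begin

lemma cont_g: "continuous_on S g"
  using deriv_g by (meson continuous_at_imp_continuous_on has_derivative_continuous)

section \<open>Decay along a solution and between nearby solutions\<close>

lemma solves_P_derivative:
  assumes "solves g x T" "0 < t" "t < T"
  shows "((\<lambda>t. P (x t)) has_vector_derivative P' (x t) (g (x t))) (at t)"
  using vector_derivative_diff_chain_within[OF solves_has_vector_derivative[OF assms]
      has_derivative_at_withinI[OF deriv_P]]
  by (simp add: o_def)

lemma solves_g_derivative:
  assumes "solves g x T" "0 < t" "t < T"
  shows "((\<lambda>t. g (x t)) has_vector_derivative A (x t) (g (x t))) (at t)"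
  using vector_derivative_diff_chain_within[OF solves_has_vector_derivative[OF assms]
      has_derivative_at_withinI[OF deriv_g]]
  by (simp add: o_def)

text \<open>The contraction inequality with \<open>v\<close> equal to the velocity. The exponent is
  \<open>2 * \<alpha>\<close> because the form is the square of the speed.\<close>

lemma velocity_decay:
  assumes x: "solves g x T" and T: "0 \<le> T"
  shows "qform (P (x T)) (g (x T)) \<le> exp (- (2 * \<alpha>) * T) * qform (P (x 0)) (g (x 0))"
proof (rule exp_decay[OF T])
  show "continuous_on {0..T} (\<lambda>t. qform (P (x t)) (g (x t)))"
    by (intro continuous_intros continuous_on_compose2[OF cont_P] continuous_on_compose2[OF cont_g[of UNIV]]
        solves_continuous_on[OF x]) auto
  fix t assume t: "0 < t" "t < T"
  show "((\<lambda>t. qform (P (x t)) (g (x t))) has_real_derivative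
      2 * (A (x t) (g (x t)) \<bullet> (P (x t) *v g (x t))) + qform (P' (x t) (g (x t))) (g (x t))) (at t)"
    by (rule has_real_derivative_qform[OF solves_g_derivative[OF x t] solves_P_derivative[OF x t] P_sym])
  show "2 * (A (x t) (g (x t)) \<bullet> (P (x t) *v g (x t))) + qform (P' (x t) (g (x t))) (g (x t))
      \<le> - (2 * \<alpha>) * qform (P (x t)) (g (x t))"
    using contraction by simp
qed

text \<open>The solution itself, rescaled to the unit interval, is the competing curve. The decay of
  the speed enters only as monotonicity, which is enough because later steps apply this to short
  pieces from shifted starting times.\<close>

lemma geodesic_dist_le_initial_velocity:
  assumes x: "solves g x T" and t: "0 \<le> t" "t \<le> T"
  shows "geodesic_dist P (x 0) (x t) \<le> t * sqrt (qform (P (x 0)) (g (x 0)))"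
proof -
  have range: "0 \<le> t * s \<and> t * s \<le> t" if "0 \<le> s" "s \<le> 1" for s
    using that t(1) by (simp add: mult_left_le)
  have contx: "continuous_on {0..1} (\<lambda>s. x (t * s))"
    by (rule continuous_on_compose2[OF solves_continuous_on[OF solves_mono[OF x t(2)]]])
      (use range in \<open>auto intro!: continuous_intros\<close>)
  obtain L where "joins P (\<lambda>s. x (t * s)) (x (t * 0)) (x (t * 1)) L"
    "L \<le> t * sqrt (qform (P (x 0)) (g (x 0)))"
  proof (rule joins_C1[of "\<lambda>s. x (t * s)" "\<lambda>s. t *\<^sub>R g (x (t * s))"])
    show "continuous_on {0..1} (\<lambda>s. t *\<^sub>R g (x (t * s)))"
      by (intro continuous_intros continuous_on_compose2[OF cont_g[of UNIV] contx]) auto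
    show "((\<lambda>s. x (t * s)) has_vector_derivative t *\<^sub>R g (x (t * s))) (at s)"
      if s: "0 < s" "s < 1" for s
    proof (cases "t = 0")
      case False
      have "((\<lambda>s. t * s) has_vector_derivative t) (at s)"
        by (auto intro!: derivative_eq_intros simp: has_vector_derivative_def)
      moreover have "(x has_vector_derivative g (x (t * s))) (at (t * s))"
      proof (rule solves_has_vector_derivative[OF x])
        have "t * s < t * 1" using s t(1) False by (intro mult_strict_left_mono) auto
        then show "t * s < T" using t(2) by simp
        show "0 < t * s" using s t(1) False by simp
      qed
      ultimately show ?thesis
        using vector_diff_chain_at[of "\<lambda>s. t * s" t s x] by (simp add: o_def)
    qed simp
    show "sqrt (qform (P (x (t * s))) (t *\<^sub>R g (x (t * s)))) \<le> t * sqrt (qform (P (x 0)) (g (x 0)))"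
      if s: "0 \<le> s" "s \<le> 1" for s
    proof -
      have "qform (P (x (t * s))) (g (x (t * s)))
          \<le> exp (- (2 * \<alpha>) * (t * s)) * qform (P (x 0)) (g (x 0))"
        using velocity_decay[OF solves_mono[OF x]] range[OF s] t by auto
      also have "\<dots> \<le> 1 * qform (P (x 0)) (g (x 0))"
        using range[OF s] \<alpha>_pos by (intro mult_right_mono) auto
      finally show ?thesis using t(1) by (simp add: real_sqrt_mult mult_left_mono)
    qed
  qed (rule contx)
  then show ?thesis using geodesic_dist_le by fastforce
qed

text \<open>
  The error \<open>e = y - x\<close> of a nearby solution obeys \<open>e' = A(x) e + o(e)\<close>, so \<open>e \<bullet> P(x) e\<close> decays
  at every rate below \<open>2\<alpha>\<close> as long as \<open>e\<close> is small, and this decay in turn keeps \<open>e\<close> small.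
\<close>

lemma nearby_solutions_contract:
  assumes x: "solves g x T" and T: "0 \<le> T" and \<beta>: "\<beta> < \<alpha>" "0 \<le> \<beta>" and \<eta>: "\<eta> > 0"
  obtains \<delta> where "\<delta> > 0"
    "\<And>y. solves g y T \<Longrightarrow> dist (y 0) (x 0) < \<delta> \<Longrightarrow> dist (y T) (x T) < \<eta> \<and>
       qform (P (x T)) (y T - x T) \<le> exp (- (2 * \<beta>) * T) * qform (P (x 0)) (y 0 - x 0)"
proof -
  let ?K = "x ` {0..T}"
  have K: "compact ?K" by (intro compact_continuous_image solves_continuous_on[OF x]) simp
  have x0: "x 0 \<in> ?K" using T by auto
  obtain c where c: "c > 0" "\<And>z v. z \<in> ?K \<Longrightarrow> c * (norm v)\<^sup>2 \<le> qform (P z) v"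
    using compact_posdef_bounds[OF K cont_P_on posdef_P] by blast
  obtain N where N: "N > 0" "\<And>(M :: real ^ 'n ^ 'n) v. norm (M *v v) \<le> norm M * norm v * N"
    using matrix_vector_mult_norm_bound by blast
  have "bounded (P ` ?K)" by (intro compact_imp_bounded compact_continuous_image K cont_P_on)
  then obtain M where M: "M > 0" "\<And>z. z \<in> ?K \<Longrightarrow> norm (P z) \<le> M"
    unfolding bounded_pos by auto
  have Pv: "norm (P z *v v) \<le> M * N * norm v" if "z \<in> ?K" for z v
  proof -
    have "norm (P z *v v) \<le> norm (P z) * norm v * N" by (rule N(2))
    also have "\<dots> \<le> M * norm v * N" using M(2)[OF that] N(1) by (intro mult_right_mono) auto
    finally show ?thesis by (simp add: mult_ac)
  qed
  have MN: "M * N > 0" using M(1) N(1) by simp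
  \<comment> \<open>With \<open>M * N\<close> bounding \<open>P\<close> and \<open>c\<close>
    bounding the form from below, a remainder of this relative size raises the derivative of the
    form by at most \<open>2 * (\<alpha> - \<beta>)\<close> times the form, exactly the permitted
    loss of rate.\<close>
  have "(\<alpha> - \<beta>) * c / (M * N) > 0" using \<beta>(1) c(1) MN by simp
  then obtain \<delta>1 where \<delta>1: "\<delta>1 > 0"
    "\<And>z y. z \<in> ?K \<Longrightarrow> dist y z < \<delta>1 \<Longrightarrow>
       norm (g y - g z - A z (y - z)) \<le> (\<alpha> - \<beta>) * c / (M * N) * norm (y - z)"
    using C1_uniform_linearization[OF deriv_g cont_A K] by blast
  define \<delta>2 where "\<delta>2 = min \<delta>1 \<eta>"
  have \<delta>2: "\<delta>2 > 0" using \<delta>1(1) \<eta> by (simp add: \<delta>2_def)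
  \<comment> \<open>Conditional on closeness before time \<open>t\<close>; a bootstrap removes the
    condition below.\<close>
  have decay: "qform (P (x t)) (y t - x t) \<le> exp (- (2 * \<beta>) * t) * qform (P (x 0)) (y 0 - x 0)"
    if y: "solves g y T" and t: "0 \<le> t" "t \<le> T"
      and close: "\<And>s. 0 < s \<Longrightarrow> s < t \<Longrightarrow> norm (y s - x s) < \<delta>1" for y t
  proof (rule exp_decay[OF t(1)])
    have xt: "solves g x t" and yt: "solves g y t" using solves_mono x y t(2) by blast+
    show "continuous_on {0..t} (\<lambda>s. qform (P (x s)) (y s - x s))"
      by (intro continuous_intros continuous_on_compose2[OF cont_P] solves_continuous_on[OF xt]
          solves_continuous_on[OF yt]) auto
    fix s assume s: "0 < s" "s < t"
    let ?e = "y s - x s" and ?u = "g (y s) - g (x s)"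
    show "((\<lambda>s. qform (P (x s)) (y s - x s)) has_real_derivative
        2 * (?u \<bullet> (P (x s) *v ?e)) + qform (P' (x s) (g (x s))) ?e) (at s)"
      by (intro has_real_derivative_qform[OF has_vector_derivative_diff] P_sym
          solves_has_vector_derivative[OF xt s] solves_has_vector_derivative[OF yt s]
          solves_P_derivative[OF xt s])
    have sK: "x s \<in> ?K" using s t by auto
    have "(?u - A (x s) ?e) \<bullet> (P (x s) *v ?e) \<le> norm (?u - A (x s) ?e) * norm (P (x s) *v ?e)"
      by (rule norm_cauchy_schwarz)
    also have "\<dots> \<le> ((\<alpha> - \<beta>) * c / (M * N) * norm ?e) * (M * N * norm ?e)"
      using close[OF s] \<beta>(1) c(1) MN
      by (intro mult_mono Pv[OF sK] \<delta>1(2)[OF sK]) (auto simp: dist_norm)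
    also have "\<dots> = (\<alpha> - \<beta>) * (c * (norm ?e)\<^sup>2)"
      using M(1) N(1) by (simp add: power2_eq_square)
    also have "\<dots> \<le> (\<alpha> - \<beta>) * qform (P (x s)) ?e"
      using \<beta>(1) c(2)[OF sK] by (intro mult_left_mono) auto
    finally have "?u \<bullet> (P (x s) *v ?e) \<le> A (x s) ?e \<bullet> (P (x s) *v ?e) + (\<alpha> - \<beta>) * qform (P (x s)) ?e"
      by (simp add: inner_diff_left)
    then show "2 * (?u \<bullet> (P (x s) *v ?e)) + qform (P' (x s) (g (x s))) ?e
        \<le> - (2 * \<beta>) * qform (P (x s)) ?e"
      using contraction[of "x s" ?e] by (simp add: algebra_simps)
  qed
  \<comment> \<open>The threshold \<open>c * \<delta>2\<^sup>2\<close> is a lower bound for the form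
    on errors of norm \<open>\<delta>2\<close>. If the form starts below it and does not exceed its
    initial value, the error cannot reach that norm.\<close>
  have "\<exists>\<delta>3>0. \<forall>v. norm v < \<delta>3 \<longrightarrow> qform (P (x 0)) v < c * \<delta>2\<^sup>2"
  proof -
    have "continuous_on UNIV (\<lambda>v. qform (P (x 0)) v)" by (intro continuous_intros)
    then have "isCont (\<lambda>v. qform (P (x 0)) v) 0" by (simp add: continuous_on_eq_continuous_at)
    moreover have "c * \<delta>2\<^sup>2 > 0" using c(1) \<delta>2 by simp
    ultimately obtain \<delta>3 where "\<delta>3 > 0"
      "\<forall>v. dist v 0 < \<delta>3 \<longrightarrow> dist (qform (P (x 0)) v) (qform (P (x 0)) 0) < c * \<delta>2\<^sup>2"
      unfolding continuous_at_eps_delta by meson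
    then show ?thesis by (auto simp: dist_real_def)
  qed
  then obtain \<delta>3 where \<delta>3: "\<delta>3 > 0" "\<And>v. norm v < \<delta>3 \<Longrightarrow> qform (P (x 0)) v < c * \<delta>2\<^sup>2" by blast
  show thesis
  proof
    show "min \<delta>2 \<delta>3 > 0" using \<delta>2 \<delta>3(1) by simp
    fix y assume y: "solves g y T" and near: "dist (y 0) (x 0) < min \<delta>2 \<delta>3"
    have cont: "continuous_on {0..T} (\<lambda>t. norm (y t - x t))"
      by (intro continuous_intros solves_continuous_on[OF x] solves_continuous_on[OF y])
    have small: "norm (y t - x t) < \<delta>2" if t: "t \<in> {0..T}" for t
    proof (rule ccontr)
      assume "\<not> norm (y t - x t) < \<delta>2"
      then obtain t0 where t0: "0 < t0" "t0 \<le> T" "norm (y t0 - x t0) = \<delta>2"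
        "\<And>s. 0 \<le> s \<Longrightarrow> s < t0 \<Longrightarrow> norm (y s - x s) < \<delta>2"
        using first_hitting_time[OF cont _ t, of \<delta>2] near by (auto simp: dist_norm)
      have "c * \<delta>2\<^sup>2 \<le> qform (P (x t0)) (y t0 - x t0)"
        using c(2)[of "x t0" "y t0 - x t0"] t0 by auto
      also have "\<dots> \<le> exp (- (2 * \<beta>) * t0) * qform (P (x 0)) (y 0 - x 0)"
        using t0 by (intro decay[OF y]) (auto simp: \<delta>2_def)
      also have "\<dots> \<le> 1 * qform (P (x 0)) (y 0 - x 0)"
        using t0(1) \<beta>(2) by (intro mult_right_mono) auto
      also have "\<dots> < c * \<delta>2\<^sup>2" using \<delta>3(2) near by (simp add: dist_norm)
      finally show False by simp
    qed
    show "dist (y T) (x T) < \<eta> \<and>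
       qform (P (x T)) (y T - x T) \<le> exp (- (2 * \<beta>) * T) * qform (P (x 0)) (y 0 - x 0)"
    proof
      show "dist (y T) (x T) < \<eta>" using small[of T] T by (auto simp: dist_norm \<delta>2_def)
      have "norm (y s - x s) < \<delta>1" if "0 < s" "s < T" for s
        using small[of s] that by (simp add: \<delta>2_def)
      then show "qform (P (x T)) (y T - x T) \<le> exp (- (2 * \<beta>) * T) * qform (P (x 0)) (y 0 - x 0)"
        using T by (intro decay[OF y]) auto
    qed
  qed
qed

text \<open>The instance \<open>\<beta> = 0\<close> of the contraction of nearby solutions: the form
  of the difference starts at 0 and cannot exceed it.\<close>

lemma solution_unique:
  assumes "solves g x T" "solves g y T" "x 0 = y 0" "0 \<le> T"
  shows "x T = y T"
proof -
  obtain \<delta> where "\<delta> > 0"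
    "\<And>y. solves g y T \<Longrightarrow> dist (y 0) (x 0) < \<delta> \<Longrightarrow> dist (y T) (x T) < 1 \<and>
       qform (P (x T)) (y T - x T) \<le> exp (- (2 * 0) * T) * qform (P (x 0)) (y 0 - x 0)"
    using nearby_solutions_contract[OF assms(1,4) \<alpha>_pos, of 1] by auto
  from this(2)[OF assms(2)] this(1) assms(3) have "qform (P (x T)) (y T - x T) \<le> 0" by simp
  then have "qform (P (x T)) (y T - x T) = 0" by (simp add: antisym)
  then show ?thesis by (simp add: posdef_P)
qed

section \<open>The global flow and its contraction\<close>

text \<open>A bounded set of horizons would have a supremum \<open>T\<close>. The speed bound makes
  the solution Cauchy as time approaches \<open>T\<close>, and the local solutions near the limit,
  all of the same duration \<open>\<tau>\<close>, continue it beyond \<open>T\<close>.\<close>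

lemma global_solution:
  assumes complete: "complete_metric P"
  obtains x where "x 0 = x0" "\<And>T. T \<ge> 0 \<Longrightarrow> solves g x T"
proof -
  define S where "S = {T. T \<ge> 0 \<and> (\<exists>x. solves g x T \<and> x 0 = x0)}"
  have "0 \<in> S"
  proof -
    obtain \<tau> x where "\<tau> > 0" "solves g x \<tau>" "x 0 = x0"
      using local_solution[OF deriv_g cont_A, of x0] by (metis dist_self zero_le_one)
    then show ?thesis using solves_mono[of g x \<tau> 0] by (auto simp: S_def)
  qed
  have S_down: "t \<in> S" if "T \<in> S" "0 \<le> t" "t \<le> T" for t T
    using that solves_mono unfolding S_def by blast
  \<comment> \<open>A possibly different solution is chosen for each \<open>t\<close> and evaluated
    at its final time; uniqueness makes the choices fit together.\<close>
  define X where "X t = (SOME x. solves g x t \<and> x 0 = x0) t" for t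
  have X_eq: "X t = y t" if y: "solves g y T" "y 0 = x0" and t: "0 \<le> t" "t \<le> T" for y t T
  proof -
    have yt: "solves g y t \<and> y 0 = x0" using y solves_mono[OF y(1) t(2)] by simp
    define w where "w = (SOME x. solves g x t \<and> x 0 = x0)"
    have "solves g w t \<and> w 0 = x0" unfolding w_def
      by (rule someI[where P = "\<lambda>x. solves g x t \<and> x 0 = x0"]) (rule yt)
    then show ?thesis
      using solution_unique[of w t y] yt t(1) by (simp add: X_def flip: w_def)
  qed
  have X: "solves g X T \<and> X 0 = x0" if T: "T \<in> S" for T
  proof -
    obtain y where y: "solves g y T" "y 0 = x0" and T0: "T \<ge> 0" using T by (auto simp: S_def)
    have "solves g X T" by (rule solves_cong[OF y(1)]) (rule X_eq[OF y])
    then show ?thesis using X_eq[OF y, of 0] T0 y(2) by simp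
  qed
  have unbounded: "\<not> bdd_above S"
  proof
    assume bdd: "bdd_above S"
    define T where "T = Sup S"
    have T0: "T \<ge> 0" using \<open>0 \<in> S\<close> bdd unfolding T_def by (rule cSup_upper)
    \<comment> \<open>Times tending to \<open>T\<close>; for \<open>T > 0\<close> they lie strictly
      below it and hence in \<open>S\<close>, whether or not \<open>T\<close> does.\<close>
    define t where "t n = T * (1 - 1 / real (Suc n))" for n
    have t_lim: "t \<longlonglongrightarrow> T"
    proof -
      have "(\<lambda>n. T * (1 - 1 / real (Suc n))) \<longlonglongrightarrow> T * (1 - 0)"
        by (intro tendsto_intros LIMSEQ_Suc lim_1_over_n)
      then show ?thesis unfolding t_def by simp
    qed
    have t_nonneg: "t n \<ge> 0" for n using T0 by (simp add: t_def)
    have tS: "t n \<in> S" for n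
    proof (cases "T = 0")
      case True
      then show ?thesis using \<open>0 \<in> S\<close> by (simp add: t_def)
    next
      case False
      then have "t n < Sup S" using T0 by (simp add: t_def T_def[symmetric] field_simps)
      then obtain s where "s \<in> S" "t n < s" using less_cSup_iff[OF _ bdd] \<open>0 \<in> S\<close> by blast
      then show ?thesis using S_down t_nonneg by (meson less_imp_le)
    qed
    define v where "v = sqrt (qform (P x0) (g x0))"
    have dist_X: "geodesic_dist P (X a) (X b) \<le> \<bar>b - a\<bar> * v" if a: "a \<in> S" and b: "b \<in> S" for a b
    proof -
      have le: "geodesic_dist P (X a) (X b) \<le> (b - a) * v" if ab: "a \<le> b" "a \<in> S" "b \<in> S" for a b
      proof -
        have a: "0 \<le> a" using ab by (simp add: S_def)
        have Xb: "solves g X b" "X 0 = x0" using X[OF ab(3)] by auto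
        have "geodesic_dist P (X a) (X b)
            \<le> (b - a) * sqrt (qform (P (X a)) (g (X a)))"
          using geodesic_dist_le_initial_velocity[OF solves_shift[OF Xb(1) a ab(1)], of "b - a"] ab(1)
          by simp
        also have "\<dots> \<le> (b - a) * v"
        proof (intro mult_left_mono)
          have "qform (P (X a)) (g (X a)) \<le> exp (- (2 * \<alpha>) * a) * qform (P x0) (g x0)"
            using velocity_decay[OF solves_mono[OF Xb(1) ab(1)] a] Xb(2) by simp
          also have "\<dots> \<le> 1 * qform (P x0) (g x0)"
            using a \<alpha>_pos by (intro mult_right_mono) auto
          finally show "sqrt (qform (P (X a)) (g (X a))) \<le> v" by (simp add: v_def)
        qed (use ab in auto)
        finally show ?thesis .
      qed
      show ?thesis
        using le[of a b] le[of b a] a b by (cases "a \<le> b") (auto simp: geodesic_dist_commute)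
    qed
    obtain p where p: "(\<lambda>n. X (t n)) \<longlonglongrightarrow> p"
    proof (rule complete_metricD[OF complete, of "\<lambda>n. X (t n)"])
      fix \<epsilon> :: real assume "\<epsilon> > 0"
      have v: "v \<ge> 0" by (simp add: v_def)
      have "Cauchy t" using t_lim by (rule LIMSEQ_imp_Cauchy)
      \<comment> \<open>\<open>v + 1\<close> in place of \<open>v\<close> covers a vanishing initial
        velocity.\<close>
      moreover have "\<epsilon> / (v + 1) > 0" using \<open>\<epsilon> > 0\<close> v by simp
      ultimately obtain k where k: "\<forall>m\<ge>k. \<forall>n\<ge>k. dist (t m) (t n) < \<epsilon> / (v + 1)"
        unfolding Cauchy_def by blast
      have "geodesic_dist P (X (t m)) (X (t n)) < \<epsilon>" if "m \<ge> k" "n \<ge> k" for m n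
      proof -
        have "geodesic_dist P (X (t m)) (X (t n)) \<le> dist (t m) (t n) * v"
          using dist_X[OF tS tS, of m n] by (simp add: dist_real_def abs_minus_commute)
        also have "\<dots> \<le> dist (t m) (t n) * (v + 1)" by (intro mult_left_mono) auto
        also have "\<dots> < \<epsilon>" using k that v by (simp add: pos_less_divide_eq)
        finally show ?thesis .
      qed
      then show "\<exists>N. \<forall>m\<ge>N. \<forall>n\<ge>N. geodesic_dist P (X (t m)) (X (t n)) < \<epsilon>" by blast
    qed (rule that)
    obtain \<tau> where \<tau>: "\<tau> > 0" "\<And>z. dist z p \<le> 1 \<Longrightarrow> \<exists>x. solves g x \<tau> \<and> x 0 = z"
      using local_solution[OF deriv_g cont_A, of p] by blast
    have "\<forall>\<^sub>F n in sequentially. dist (X (t n)) p < 1" using tendstoD[OF p] by simp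
    moreover have "\<forall>\<^sub>F n in sequentially. T - \<tau> < t n"
      using order_tendstoD(1)[OF t_lim] \<tau>(1) by simp
    ultimately obtain n where n: "dist (X (t n)) p < 1" "T - \<tau> < t n"
      using eventually_happens[OF eventually_conj] by fastforce
    then obtain y where y: "solves g y \<tau>" "y 0 = X (t n)" using \<tau>(2) by (meson less_imp_le)
    have "solves g (\<lambda>s. if s \<in> {0..t n} then X s else y (s - t n)) (t n + \<tau>)"
      using X[OF tS, of n] y \<tau>(1) t_nonneg by (intro solves_append) auto
    then have "t n + \<tau> \<in> S"
      using t_nonneg[of n] \<tau>(1) X[OF tS, of n] unfolding S_def
      by (auto intro!: exI[of _ "\<lambda>s. if s \<in> {0..t n} then X s else y (s - t n)"])
    then have "t n + \<tau> \<le> T" unfolding T_def using bdd by (rule cSup_upper)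
    then show False using n(2) by simp
  qed
  have "T \<in> S" if "T \<ge> 0" for T
    using unbounded that S_down unfolding bdd_above_def by (meson linear)
  then show thesis using X \<open>0 \<in> S\<close> by (intro that[of X]) auto
qed

text \<open>
  Exact solutions through the points of a curve \<open>\<gamma>\<close> are compared with the solution through one
  point \<open>\<gamma> s\<close> only locally in \<open>s\<close>, which avoids differentiating the flow in its initial
  condition. The factor \<open>k\<close> absorbs the variation of \<open>P\<close> near \<open>\<gamma> s\<close> and near the end point.
\<close>

lemma curve_contraction:
  assumes complete: "complete_metric P" and \<gamma>: "joins P \<gamma> p q L"
    and k: "k > 1" and \<beta>: "\<beta> < \<alpha>" "0 \<le> \<beta>" and T: "0 \<le> T"
    and xy: "solves g x T" "x 0 = p" "solves g y T" "y 0 = q"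
  shows "geodesic_dist P (x T) (y T) \<le> k\<^sup>2 * exp (- \<beta> * T) * L"
proof -
  have vp: "valid_path \<gamma>" and ends: "\<gamma> 0 = p" "\<gamma> 1 = q"
    and L: "(speed P \<gamma> has_integral L) {0..1}"
    using \<gamma> by (auto simp: joins_def pathstart_def pathfinish_def)
  have int: "speed P \<gamma> integrable_on {0..1}" using L by blast
  have cont: "continuous_on {0..1} \<gamma>" using valid_path_imp_path[OF vp] by (simp add: path_def)
  \<comment> \<open>One factor \<open>k\<close> compares the chord at time 0 with the arc, the other
    compares the segment at time \<open>T\<close> with the form frozen at its end.\<close>
  define C where "C = k\<^sup>2 * exp (- \<beta> * T)"
  \<comment> \<open>An additive property of intervals for bisection. The guards are needed because
    the short intervals around a point may stick out of the unit interval; quantifying over all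
    solutions lets two pieces share any solution through the common point.\<close>
  define Q where "Q a b \<longleftrightarrow> (0 \<le> a \<longrightarrow> a \<le> b \<longrightarrow> b \<le> 1 \<longrightarrow> (\<forall>x y. solves g x T \<longrightarrow> x 0 = \<gamma> a \<longrightarrow>
    solves g y T \<longrightarrow> y 0 = \<gamma> b \<longrightarrow> geodesic_dist P (x T) (y T) \<le> C * integral {a..b} (speed P \<gamma>)))"
    for a b
  have combine: "geodesic_dist P u w \<le> C * integral {a..b} (speed P \<gamma>)"
    if "geodesic_dist P u v \<le> C * integral {a..s} (speed P \<gamma>)"
      "geodesic_dist P v w \<le> C * integral {s..b} (speed P \<gamma>)"
      "0 \<le> a" "a \<le> s" "s \<le> b" "b \<le> 1" for u v w a s b
  proof -
    have "speed P \<gamma> integrable_on {a..b}"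
      by (rule integrable_subinterval_real[OF int]) (use that in auto)
    then have "integral {a..s} (speed P \<gamma>) + integral {s..b} (speed P \<gamma>) = integral {a..b} (speed P \<gamma>)"
      by (rule Henstock_Kurzweil_Integration.integral_combine[OF that(4,5)])
    then have "C * integral {a..b} (speed P \<gamma>) =
        C * integral {a..s} (speed P \<gamma>) + C * integral {s..b} (speed P \<gamma>)"
      by (metis distrib_left)
    then show ?thesis using that(1,2) geodesic_dist_triangle[of u w v] by linarith
  qed
  have "Q 0 1"
    using zero_le_one
  proof (induction rule: Bolzano)
    case (trans a s b)
    show ?case
      unfolding Q_def
    proof (intro impI allI)
      fix x y assume ab: "0 \<le> a" "a \<le> b" "b \<le> 1"
        and x: "solves g x T" "x 0 = \<gamma> a" and y: "solves g y T" "y 0 = \<gamma> b"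
      \<comment> \<open>Completeness provides a solution through the intermediate point that lasts
        until \<open>T\<close>.\<close>
      obtain z where z: "solves g z T" "z 0 = \<gamma> s" using global_solution[OF complete] T by metis
      show "geodesic_dist P (x T) (y T) \<le> C * integral {a..b} (speed P \<gamma>)"
      proof (rule combine)
        show "geodesic_dist P (x T) (z T) \<le> C * integral {a..s} (speed P \<gamma>)"
          by (rule trans(1)[unfolded Q_def, rule_format, OF _ _ _ x z]) (use ab trans(3,4) in auto)
        show "geodesic_dist P (z T) (y T) \<le> C * integral {s..b} (speed P \<gamma>)"
          by (rule trans(2)[unfolded Q_def, rule_format, OF _ _ _ z y]) (use ab trans(3,4) in auto)
      qed (use ab trans(3,4) in auto)
    qed
  next
    case (local s)
    obtain z where z: "solves g z T" "z 0 = \<gamma> s" using global_solution[OF complete] T by metis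
    obtain \<delta>1 where \<delta>1: "\<delta>1 > 0"
      "\<And>u v. dist u (\<gamma> s) < \<delta>1 \<Longrightarrow> sqrt (qform (P (\<gamma> s)) v) \<le> k * sqrt (qform (P u) v)"
      using posdef_comparison[OF cont_P posdef_P k, of "\<gamma> s"] by metis
    \<comment> \<open>This radius becomes \<open>\<eta>\<close> for the nearby solutions, so that
      the segment between the end points stays where the comparison holds.\<close>
    obtain \<delta>2 where \<delta>2: "\<delta>2 > 0"
      "\<And>u v. dist u (z T) < \<delta>2 \<Longrightarrow> sqrt (qform (P u) v) \<le> k * sqrt (qform (P (z T)) v)"
      using posdef_comparison[OF cont_P posdef_P k, of "z T"] by metis
    obtain \<delta>3 where \<delta>3: "\<delta>3 > 0"
      "\<And>y. solves g y T \<Longrightarrow> dist (y 0) (z 0) < \<delta>3 \<Longrightarrow> dist (y T) (z T) < \<delta>2 \<and>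
         qform (P (z T)) (y T - z T) \<le> exp (- (2 * \<beta>) * T) * qform (P (z 0)) (y 0 - z 0)"
      using nearby_solutions_contract[OF z(1) T \<beta> \<delta>2(1)] by blast
    have "min \<delta>1 \<delta>3 > 0" using \<delta>1(1) \<delta>3(1) by simp
    then obtain d where d: "d > 0"
      "\<And>r. r \<in> {0..1} \<Longrightarrow> dist r s < d \<Longrightarrow> dist (\<gamma> r) (\<gamma> s) < min \<delta>1 \<delta>3"
      using cont[unfolded continuous_on_iff] local by (metis atLeastAtMost_iff)
    \<comment> \<open>The segment at time \<open>T\<close> is measured in the form at
      \<open>z T\<close>, and contraction carries this back to the chord at time 0. \<open>I\<close>
      stands for the arc length, on either side of \<open>s\<close>.\<close>
    have chord: "geodesic_dist P (z T) (y T) \<le> C * I"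
      if y: "solves g y T" "y 0 = \<gamma> r" and r: "r \<in> {0..1}" "dist r s < d"
        and I: "sqrt (qform (P (\<gamma> s)) (\<gamma> r - \<gamma> s)) \<le> k * I" for y r I
    proof -
      have near: "dist (y T) (z T) < \<delta>2"
        "qform (P (z T)) (y T - z T) \<le> exp (- (2 * \<beta>) * T) * qform (P (\<gamma> s)) (\<gamma> r - \<gamma> s)"
        using \<delta>3(2)[OF y(1)] d(2)[OF r] y(2) z(2) by auto
      have "geodesic_dist P (z T) (y T) \<le> k * sqrt (qform (P (z T)) (y T - z T))"
      proof (rule geodesic_dist_le_segment)
        fix u assume "u \<in> closed_segment (z T) (y T)"
        then have "dist u (z T) \<le> dist (y T) (z T)"
          using dist_in_closed_segment(1)[of u "z T" "y T"] by (simp add: dist_commute)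
        then show "sqrt (qform (P u) (y T - z T)) \<le> k * sqrt (qform (P (z T)) (y T - z T))"
          using near(1) by (intro \<delta>2(2)) auto
      qed
      also have "\<dots> \<le> k * (exp (- \<beta> * T) * sqrt (qform (P (\<gamma> s)) (\<gamma> r - \<gamma> s)))"
      proof (intro mult_left_mono)
        have "exp (- (2 * \<beta>) * T) = (exp (- \<beta> * T))\<^sup>2"
          by (simp add: power2_eq_square flip: exp_add)
        then show "sqrt (qform (P (z T)) (y T - z T))
            \<le> exp (- \<beta> * T) * sqrt (qform (P (\<gamma> s)) (\<gamma> r - \<gamma> s))"
          using real_sqrt_le_mono[OF near(2)] by (simp add: real_sqrt_mult)
      qed (use k in auto)
      also have "\<dots> \<le> k * (exp (- \<beta> * T) * (k * I))"
        using I k by (intro mult_left_mono) auto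
      also have "\<dots> = C * I" by (simp add: C_def power2_eq_square)
      finally show ?thesis .
    qed
    show ?case
    proof (intro exI[of _ d] conjI allI impI d(1))
      fix a b assume ab: "a \<le> s \<and> s \<le> b \<and> b - a < d"
      show "Q a b"
        unfolding Q_def
      proof (intro impI allI)
        fix x y assume bounds: "0 \<le> a" "a \<le> b" "b \<le> 1"
          and x: "solves g x T" "x 0 = \<gamma> a" and y: "solves g y T" "y 0 = \<gamma> b"
        have comp: "sqrt (qform (P (\<gamma> s)) v) \<le> k * sqrt (qform (P (\<gamma> r)) v)"
          if "a \<le> r" "r \<le> b" for r v
          using that ab bounds by (intro \<delta>1(2) less_le_trans[OF d(2)]) (auto simp: dist_real_def)
        have "sqrt (qform (P (\<gamma> s)) (\<gamma> s - \<gamma> a)) \<le> k * integral {a..s} (speed P \<gamma>)"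
          using ab bounds k comp by (intro chord_le_length[OF vp int]) auto
        then have "geodesic_dist P (z T) (x T) \<le> C * integral {a..s} (speed P \<gamma>)"
          using ab bounds by (intro chord[OF x]) (auto simp: dist_real_def qform_minus_commute)
        moreover have "sqrt (qform (P (\<gamma> s)) (\<gamma> b - \<gamma> s)) \<le> k * integral {s..b} (speed P \<gamma>)"
          using ab bounds k comp by (intro chord_le_length[OF vp int]) auto
        then have "geodesic_dist P (z T) (y T) \<le> C * integral {s..b} (speed P \<gamma>)"
          using ab bounds by (intro chord[OF y]) (auto simp: dist_real_def)
        ultimately show "geodesic_dist P (x T) (y T) \<le> C * integral {a..b} (speed P \<gamma>)"
          using ab bounds by (metis combine geodesic_dist_commute)
      qed
    qed
  qed
  then have "geodesic_dist P (x T) (y T) \<le> C * integral {0..1} (speed P \<gamma>)"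
    using xy ends by (simp add: Q_def)
  then show ?thesis using integral_unique[OF L] by (simp add: C_def)
qed

text \<open>The curve estimate with \<open>k = 1 + \<epsilon>\<close> and
  \<open>\<beta> = \<alpha> - \<epsilon>\<close>: both losses vanish as \<epsilon> tends to 0, and
  the infimum over curves is taken afterwards.\<close>

lemma geodesic_dist_contraction:
  assumes "complete_metric P" "solves g x T" "solves g y T" "0 \<le> T"
  shows "geodesic_dist P (x T) (y T) \<le> exp (- \<alpha> * T) * geodesic_dist P (x 0) (y 0)"
proof -
  have "geodesic_dist P (x T) (y T) \<le> exp (- \<alpha> * T) * L" if L: "joins P \<gamma> (x 0) (y 0) L" for \<gamma> L
  proof (rule tendsto_lowerbound)
    show "((\<lambda>\<epsilon>. (1 + \<epsilon>)\<^sup>2 * exp (- (\<alpha> - \<epsilon>) * T) * L) \<longlongrightarrow> exp (- \<alpha> * T) * L) (at_right 0)"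
      by (auto intro!: tendsto_eq_intros)
    have "\<forall>\<^sub>F \<epsilon> in at_right 0. \<epsilon> \<in> {0<..<\<alpha>}"
      by (rule eventually_at_right_real[OF \<alpha>_pos])
    then show "\<forall>\<^sub>F \<epsilon> in at_right 0. geodesic_dist P (x T) (y T) \<le> (1 + \<epsilon>)\<^sup>2 * exp (- (\<alpha> - \<epsilon>) * T) * L"
      by (rule eventually_mono) (rule curve_contraction[OF assms(1) L _ _ _ assms(4,2) _ assms(3)], auto)
  qed simp
  then have "exp (\<alpha> * T) * geodesic_dist P (x T) (y T) \<le> geodesic_dist P (x 0) (y 0)"
    by (intro geodesic_dist_greatest) (simp add: exp_minus field_simps)
  then show ?thesis by (simp add: exp_minus field_simps)
qed

section \<open>The equilibrium and convergence towards it\<close>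

text \<open>Sampled at integer times, a solution makes steps bounded by a geometric sequence with
  ratio \<open>exp (- \<alpha>)\<close>, so the samples converge. The speed is a continuous function
  of the point and tends to 0 along them, so it vanishes at the limit.\<close>

lemma equilibrium_exists:
  assumes complete: "complete_metric P"
  obtains p where "g p = 0"
proof -
  obtain x where x: "x 0 = 0" "\<And>T. T \<ge> 0 \<Longrightarrow> solves g x T"
    using global_solution[OF complete, of 0] by metis
  define \<sigma> where "\<sigma> n = x (real n)" for n
  define v where "v = sqrt (qform (P (x 0)) (g (x 0)))"
  define r where "r = exp (- \<alpha>)"
  have r: "0 < r" "r < 1" using \<alpha>_pos by (auto simp: r_def)
  have v: "v \<ge> 0" by (simp add: v_def)
  have vel: "sqrt (qform (P (\<sigma> n)) (g (\<sigma> n))) \<le> v * r ^ n" for n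
  proof -
    have "exp (- (2 * \<alpha>) * real n) = (r ^ n)\<^sup>2"
      by (simp add: r_def power2_eq_square exp_of_nat_mult[symmetric] flip: exp_add)
    then have "qform (P (\<sigma> n)) (g (\<sigma> n)) \<le> (r ^ n)\<^sup>2 * qform (P (x 0)) (g (x 0))"
      using velocity_decay[OF x(2), of "real n"] by (simp add: \<sigma>_def)
    from real_sqrt_le_mono[OF this] show ?thesis
      using r by (simp add: real_sqrt_mult v_def mult.commute)
  qed
  have step: "geodesic_dist P (\<sigma> n) (\<sigma> (Suc n)) \<le> v * r ^ n" for n
  proof -
    have "solves g (\<lambda>t. x (t + real n)) (real n + 1 - real n)"
      by (rule solves_shift) (auto intro: x)
    from geodesic_dist_le_initial_velocity[OF this, of 1] vel[of n]
    show ?thesis by (simp add: \<sigma>_def add.commute)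
  qed
  \<comment> \<open>Multiplied by \<open>1 - r\<close>, the partial geometric sum telescopes, and
    the induction closes without division.\<close>
  have geometric: "(1 - r) * geodesic_dist P (\<sigma> n) (\<sigma> (n + k)) \<le> v * r ^ n * (1 - r ^ k)" for n k
  proof (induction k)
    case (Suc k)
    have "(1 - r) * geodesic_dist P (\<sigma> n) (\<sigma> (n + Suc k))
        \<le> (1 - r) * (geodesic_dist P (\<sigma> n) (\<sigma> (n + k)) + v * r ^ (n + k))"
      using geodesic_dist_triangle[of "\<sigma> n" "\<sigma> (n + Suc k)" "\<sigma> (n + k)"] step[of "n + k"] r
      by (intro mult_left_mono) auto
    also have "\<dots> \<le> v * r ^ n * (1 - r ^ k) + (1 - r) * (v * r ^ (n + k))"
      using Suc by (simp add: distrib_left)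
    also have "\<dots> = v * r ^ n * (1 - r ^ Suc k)" by (simp add: algebra_simps power_add)
    finally show ?case .
  qed simp
  have tail: "geodesic_dist P (\<sigma> m) (\<sigma> n) \<le> v / (1 - r) * r ^ min m n" for m n
  proof -
    have le: "geodesic_dist P (\<sigma> m) (\<sigma> n) \<le> v / (1 - r) * r ^ m" if "m \<le> n" for m n
    proof -
      have "(1 - r) * geodesic_dist P (\<sigma> m) (\<sigma> n) \<le> v * r ^ m * (1 - r ^ (n - m))"
        using geometric[of m "n - m"] that by simp
      also have "\<dots> \<le> v * r ^ m * 1" using v r by (intro mult_left_mono) auto
      finally show ?thesis using r by (simp add: field_simps)
    qed
    show ?thesis
      using le[of m n] le[of n m] geodesic_dist_commute[of "\<sigma> m" "\<sigma> n"] by (cases "m \<le> n") auto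
  qed
  have r_lim: "(\<lambda>n. C * r ^ n) \<longlonglongrightarrow> 0" for C
    using tendsto_mult_right_zero[OF LIMSEQ_power_zero[of r]] r by simp
  obtain p where p: "\<sigma> \<longlonglongrightarrow> p"
  proof (rule complete_metricD[OF complete, of \<sigma>])
    fix \<epsilon> :: real assume "\<epsilon> > 0"
    then obtain N where N: "\<And>n. n \<ge> N \<Longrightarrow> v / (1 - r) * r ^ n < \<epsilon>"
      using order_tendstoD(2)[OF r_lim] unfolding eventually_sequentially by blast
    have "geodesic_dist P (\<sigma> m) (\<sigma> n) < \<epsilon>" if "m \<ge> N" "n \<ge> N" for m n
      using le_less_trans[OF tail N] that by simp
    then show "\<exists>N. \<forall>m\<ge>N. \<forall>n\<ge>N. geodesic_dist P (\<sigma> m) (\<sigma> n) < \<epsilon>" by blast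
  qed (rule that)
  have "continuous_on UNIV (\<lambda>z. sqrt (qform (P z) (g z)))"
    by (intro continuous_intros cont_P cont_g)
  then have "(\<lambda>n. sqrt (qform (P (\<sigma> n)) (g (\<sigma> n)))) \<longlonglongrightarrow> sqrt (qform (P p) (g p))"
    by (rule continuous_on_tendsto_compose[OF _ p, where s = UNIV]) auto
  then have "sqrt (qform (P p) (g p)) \<le> 0"
    by (rule LIMSEQ_le[OF _ r_lim]) (use vel in auto)
  then have "qform (P p) (g p) = 0" by (simp add: antisym)
  then show thesis using that by (simp add: posdef_P)
qed

text \<open>The comparison solution is the constant one at \<open>p\<close>. Convergence in norm is
  recorded too, since the continuity of \<open>f\<close> refers to it.\<close>

lemma convergence_to_equilibrium:
  assumes complete: "complete_metric P" and p: "g p = 0" and x: "\<And>T. T \<ge> 0 \<Longrightarrow> solves g x T"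
  shows "t \<ge> 0 \<Longrightarrow> geodesic_dist P (x t) p \<le> exp (- \<alpha> * t) * geodesic_dist P (x 0) p"
    and "(x \<longlongrightarrow> p) at_top"
proof -
  show bound: "geodesic_dist P (x t) p \<le> exp (- \<alpha> * t) * geodesic_dist P (x 0) p" if "t \<ge> 0" for t
  proof -
    have "solves g (\<lambda>_. p) t" using p by (simp add: solves_def)
    from geodesic_dist_contraction[OF complete x[OF that] this that] show ?thesis .
  qed
  have "((\<lambda>t. exp (- \<alpha> * t)) \<longlongrightarrow> 0) at_top"
    using \<alpha>_pos by (intro filterlim_compose[OF exp_at_bot] filterlim_tendsto_neg_mult_at_bot[OF tendsto_const])
      (auto intro: filterlim_ident)
  then have lim: "((\<lambda>t. exp (- \<alpha> * t) * geodesic_dist P (x 0) p) \<longlongrightarrow> 0) at_top"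
    by (rule tendsto_mult_left_zero)
  have le: "\<forall>\<^sub>F t in at_top. geodesic_dist P (x t) p \<le> exp (- \<alpha> * t) * geodesic_dist P (x 0) p"
    using eventually_ge_at_top[of 0] by (rule eventually_mono) (rule bound)
  have "((\<lambda>t. geodesic_dist P (x t) p) \<longlongrightarrow> 0) at_top"
    by (rule tendsto_sandwich[OF _ le tendsto_const lim]) simp
  then show "(x \<longlongrightarrow> p) at_top" by (rule geodesic_dist_tendsto_0_imp_tendsto)
qed

end

section \<open>Gradient descent\<close>

lemma gradient_C2:
  fixes f :: "'a::euclidean_space \<Rightarrow> real"
  assumes "C2_map f"
  obtains A :: "'a \<Rightarrow> 'a \<Rightarrow>\<^sub>L 'a"
  where "\<And>x. (f has_derivative (\<lambda>h. h \<bullet> gradient f x)) (at x)"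
    "\<And>x. ((\<lambda>x. - gradient f x) has_derivative blinfun_apply (A x)) (at x)" "continuous_on UNIV A"
proof -
  obtain F' where F': "\<And>x. (f has_derivative blinfun_apply (F' x)) (at x)" and "C1_map F'"
    using assms unfolding C2_map_def by blast
  then obtain F'' where F'': "\<And>x. (F' has_derivative blinfun_apply (F'' x)) (at x)"
    "continuous_on UNIV F''"
    unfolding C1_map_def by blast
  \<comment> \<open>\<open>- R\<close> is the Riesz map written in an orthonormal basis. As
    \<open>R\<close> is bounded linear, the negative gradient, \<open>R\<close> after the derivative
    of \<open>f\<close>, inherits C1 from that derivative.\<close>
  define R where "R L = - (\<Sum>b\<in>Basis. blinfun_apply L b *\<^sub>R b)" for L :: "'a \<Rightarrow>\<^sub>L real"
  have R: "bounded_linear R"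
    unfolding R_def by (intro bounded_linear_minus bounded_linear_sum bounded_linear_scaleR_const blinfun.bounded_linear_left)
  have R_inner: "blinfun_apply L = (\<lambda>h. h \<bullet> - R L)" for L
  proof
    fix h
    have "blinfun_apply L h = blinfun_apply L (\<Sum>b\<in>Basis. (h \<bullet> b) *\<^sub>R b)"
      by (simp add: euclidean_representation)
    also have "\<dots> = h \<bullet> - R L"
      by (simp add: R_def blinfun.sum_right blinfun.scaleR_right inner_sum_right mult.commute)
    finally show "blinfun_apply L h = h \<bullet> - R L" .
  qed
  have deriv: "(f has_derivative (\<lambda>h. h \<bullet> - R (F' x))) (at x)" for x
    using F'[of x] by (subst (asm) R_inner)
  have grad: "gradient f x = - R (F' x)" for x
    by (rule gradient_eqI) (simp only: gderiv_def deriv)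
  show thesis
  proof (rule that[of "\<lambda>x. Blinfun R o\<^sub>L F'' x"])
    fix x
    show "(f has_derivative (\<lambda>h. h \<bullet> gradient f x)) (at x)"
      unfolding grad by (rule deriv)
    have "(\<lambda>x. - gradient f x) = (\<lambda>x. R (F' x))" by (simp add: grad)
    then show "((\<lambda>x. - gradient f x) has_derivative blinfun_apply (Blinfun R o\<^sub>L F'' x)) (at x)"
      using bounded_linear.has_derivative[OF R F''(1)[of x]]
      by (simp add: blinfun_compose.rep_eq bounded_linear_Blinfun_apply[OF R] o_def)
    show "continuous_on UNIV (\<lambda>x. Blinfun R o\<^sub>L F'' x)"
      by (intro bounded_bilinear.continuous_on[OF bounded_bilinear_blinfun_compose]
          continuous_on_const F''(2))
  qed
qed

section \<open>From matrices and partial derivatives to directional derivatives\<close>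

text \<open>Linearity recombines the partial derivatives into the derivative in the direction of the
  field, the form in which the chain rule along a solution produces it.\<close>

lemma metric_dot_eq:
  fixes P :: "real ^ 'n \<Rightarrow> real ^ 'n ^ 'n"
  assumes "(P has_derivative P') (at x)"
  shows "metric_dot P h x t = P' (h x t)"
proof -
  have eq: "frechet_derivative P (at x) = P'" using frechet_derivative_at[OF assms] by simp
  have "metric_dot P h x t = P' (\<Sum>i\<in>UNIV. (h x t $ i) *\<^sub>R axis i 1)"
    using has_derivative_linear[OF assms] unfolding metric_dot_def eq
    by (simp add: linear_sum linear_scale o_def)
  also have "(\<Sum>i\<in>UNIV. (h x t $ i) *\<^sub>R axis i 1) = h x t"
    using basis_expansion[of "h x t"] by (simp add: scalar_mult_eq_scaleR)
  finally show ?thesis .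
qed

lemma jacobian_eq:
  fixes h :: "real ^ 'n \<Rightarrow> real ^ 'm"
  assumes "(h has_derivative h') (at x)"
  shows "jacobian h (at x) *v v = h' v"
proof -
  have "(h has_derivative (\<lambda>v. jacobian h (at x) *v v)) (at x)"
    using assms jacobian_works differentiable_def by blast
  from has_derivative_unique[OF this assms] show ?thesis by metis
qed

lemma contracting_field_of_contracting:
  fixes P :: "real ^ 'n \<Rightarrow> real ^ 'n ^ 'n" and A :: "real ^ 'n \<Rightarrow> (real ^ 'n) \<Rightarrow>\<^sub>L (real ^ 'n)"
  assumes "contracting (\<lambda>x t. g x) P \<alpha>"
    and g: "\<And>x. (g has_derivative blinfun_apply (A x)) (at x)" and "continuous_on UNIV A"
  obtains P' where "contracting_field P g A P' \<alpha>"
proof -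
  have pd: "\<And>x. posdef (P x)" and "C1_map P" and \<alpha>: "\<alpha> > 0"
    using assms(1) by (auto simp: contracting_def riemannian_metric_def)
  then obtain P' where P': "\<And>x. (P has_derivative blinfun_apply (P' x)) (at x)"
    unfolding C1_map_def by blast
  have "2 * (A x v \<bullet> (P x *v v)) + qform (P' x (g x)) v \<le> - 2 * \<alpha> * qform (P x) v" for x v
  proof -
    let ?J = "jacobian g (at x)"
    \<comment> \<open>The field is autonomous, so time 0 represents all times.\<close>
    have "metric_dot P (\<lambda>x t. g x) x 0 + transpose ?J ** P x + P x ** ?J \<preceq>\<^sub>L (- 2 * \<alpha>) *\<^sub>R P x"
      using assms(1) by (simp add: contracting_def Let_def)
    then have "0 \<le> v \<bullet> (((- 2 * \<alpha>) *\<^sub>R P x - (P' x (g x) + transpose ?J ** P x + P x ** ?J)) *v v)"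
      by (simp add: loewner_le_def metric_dot_eq[OF P'])
    moreover have "v \<bullet> ((transpose ?J ** P x) *v v) = A x v \<bullet> (P x *v v)"
      by (metis jacobian_eq[OF g] matrix_vector_mul_assoc dot_lmul_matrix inner_commute
          transpose_matrix_vector)
    moreover have "v \<bullet> ((P x ** ?J) *v v) = A x v \<bullet> (P x *v v)"
      using posdef_sym[OF pd, of v x "A x v"]
      by (simp add: jacobian_eq[OF g] flip: matrix_vector_mul_assoc)
    moreover have "v \<bullet> (- ((2 * \<alpha>) *\<^sub>R P x) *v v) = - 2 * \<alpha> * (v \<bullet> (P x *v v))"
      using scaleR_matrix_vector_assoc[of "- 2 * \<alpha>" "P x" v, symmetric] by simp
    ultimately show ?thesis
      by (simp add: qform_def matrix_vector_mult_diff_rdistrib matrix_vector_mult_add_rdistrib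
          inner_diff_right inner_add_right)
  qed
  moreover have "continuous_on UNIV P"
    using P' by (meson continuous_at_imp_continuous_on has_derivative_continuous)
  ultimately have "contracting_field P g A P' \<alpha>"
    using pd \<alpha> g assms(3) P' by unfold_locales auto
  then show thesis by (rule that)
qed

lemma solution_iff_solves:
  "solution (\<lambda>x t. g x) x \<longleftrightarrow> (\<forall>T\<ge>0. solves g x T)"
proof
  assume "solution (\<lambda>x t. g x) x"
  then show "\<forall>T\<ge>0. solves g x T"
    unfolding solution_def solves_def
    by (auto intro: has_vector_derivative_within_subset[where S = "{0..}"])
next
  assume "\<forall>T\<ge>0. solves g x T"
  then show "solution (\<lambda>x t. g x) x"
    unfolding solution_def using solves_all_imp_derivative by blast
qed

section \<open>Minimizers of \<open>f\<close>\<close>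

text \<open>Along a solution the derivative of \<open>f\<close> is minus the squared norm of the
  gradient.\<close>

lemma gradient_descent_decreasing:
  assumes f: "\<And>x. (f has_derivative (\<lambda>h. h \<bullet> gradient f x)) (at x)"
    and x: "solves (\<lambda>x. - gradient f x) x T" and T: "0 \<le> T"
  shows "f (x T) \<le> f (x 0)"
proof (rule DERIV_nonpos_imp_decreasing_open[OF T])
  fix t assume t: "0 < t" "t < T"
  have "((\<lambda>t. f (x t)) has_vector_derivative - gradient f (x t) \<bullet> gradient f (x t)) (at t)"
    using vector_derivative_diff_chain_within[OF solves_has_vector_derivative[OF x t]
        has_derivative_at_withinI[OF f]]
    by (simp add: o_def)
  then show "\<exists>y. ((\<lambda>t. f (x t)) has_real_derivative y) (at t) \<and> y \<le> 0"
    by (intro exI[of _ "- gradient f (x t) \<bullet> gradient f (x t)"])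
      (simp add: has_real_derivative_iff_has_vector_derivative)
next
  have "continuous_on UNIV f"
    using f by (meson continuous_at_imp_continuous_on has_derivative_continuous)
  then show "continuous_on {0..T} (\<lambda>t. f (x t))"
    by (rule continuous_on_compose2[OF _ solves_continuous_on[OF x]]) simp
qed

theorem proposition2:
  fixes f :: "real ^ 'n \<Rightarrow> real"
    and P :: "real ^ 'n \<Rightarrow> real ^ 'n ^ 'n"
    and \<alpha> :: real
  assumes "C2_map f"
    and "contracting (gradient_descent f) P \<alpha>"
    and "complete_metric P"
  shows "\<exists>xs. (\<forall>y. f xs \<le> f y) \<and> (\<forall>z. (\<forall>y. f z \<le> f y) \<longrightarrow> z = xs) \<and>
    (\<forall>x0. \<exists>x. solution (gradient_descent f) x \<and> x 0 = x0) \<and>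
    (\<forall>x. solution (gradient_descent f) x \<longrightarrow>
       (\<forall>t\<ge>0. geodesic_dist P (x t) xs \<le> exp (- \<alpha> * t) * geodesic_dist P (x 0) xs))"
proof -
  let ?g = "\<lambda>x. - gradient f x"
  obtain A where f: "\<And>x. (f has_derivative (\<lambda>h. h \<bullet> gradient f x)) (at x)"
    and A: "\<And>x. (?g has_derivative blinfun_apply (A x)) (at x)" "continuous_on UNIV A"
    using gradient_C2[OF assms(1)] by blast
  obtain P' where "contracting_field P ?g A P' \<alpha>"
    using contracting_field_of_contracting[OF assms(2) A] by blast
  then interpret contracting_field P ?g A P' \<alpha> .
  obtain xs where xs: "?g xs = 0" using equilibrium_exists[OF assms(3)] by blast
  have exists: "\<exists>x. (\<forall>T\<ge>0. solves ?g x T) \<and> x 0 = x0" for x0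
    using global_solution[OF assms(3), of x0] by metis
  \<comment> \<open>Every \<open>y\<close> starts a solution that tends to \<open>xs\<close>, and
    the values of \<open>f\<close> along it never exceed \<open>f y\<close>.\<close>
  have min: "f xs \<le> f y" for y
  proof -
    obtain x where x: "x 0 = y" "\<And>T. T \<ge> 0 \<Longrightarrow> solves ?g x T" using exists by blast
    have "isCont f xs" using f by (rule has_derivative_continuous)
    then have "((\<lambda>t. f (x t)) \<longlongrightarrow> f xs) at_top"
      using convergence_to_equilibrium(2)[OF assms(3) xs x(2)] by (rule isCont_tendsto_compose)
    moreover have "\<forall>\<^sub>F t in at_top. f (x t) \<le> f y"
      using eventually_ge_at_top[of 0]
      by (rule eventually_mono) (use gradient_descent_decreasing[OF f x(2)] x(1) in auto)
    ultimately show ?thesis by (intro tendsto_upperbound) auto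
  qed
  \<comment> \<open>A minimizer is a critical point and hence a constant solution, which tends to
    \<open>xs\<close> only if it equals \<open>xs\<close>.\<close>
  have unique: "z = xs" if z: "\<And>y. f z \<le> f y" for z
  proof -
    have "(\<lambda>h. h \<bullet> gradient f z) = (\<lambda>_. 0)"
      using differential_zero_maxmin[of z UNIV f] f z by auto
    then have "?g z = 0" by (metis inner_eq_zero_iff neg_equal_0_iff_equal)
    then have "((\<lambda>_. z) \<longlongrightarrow> xs) (at_top :: real filter)"
      by (intro convergence_to_equilibrium(2)[OF assms(3) xs]) (simp add: solves_def)
    then show ?thesis by (simp add: tendsto_const_iff)
  qed
  have "geodesic_dist P (x t) xs \<le> exp (- \<alpha> * t) * geodesic_dist P (x 0) xs"
    if "solution (gradient_descent f) x" "t \<ge> 0" for x t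
    using convergence_to_equilibrium(1)[OF assms(3) xs _ that(2)] that(1)
    by (simp add: solution_iff_solves)
  then show ?thesis
    using min unique exists by (intro exI[of _ xs]) (auto simp: solution_iff_solves)
qed

end
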